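(* Let $\Omega\subset\mathbb R^n$ be open, $X=L^2(\Omega)$, $-\infty\le a<b\le\infty$, and $$C=\{x\in L^2(\Omega)\mid a\le x(y)\le b\ \text{ a.e. } y\in\Omega\}.$$ Let $(\mathcal P,d)$ be a metric space, $f\colon X\times\mathcal P\to X$ a mapping, and let $\bar x\in\hat S(\bar v,\bar p)$, where $\hat S(v,p)=\{x\in X\mid v\in f(x,p)+N_C(x)\}$. Assume that (A1) and (A4) (see context) are satisfied and that $Q(w):=\langle\nabla_xf(\bar x,\bar p)w,w\rangle$, $w\in L^2(\Omega)$, is a Legendre form. Then $\bar x$ is a (Lipschitzian) fully stable solution to $v\in f(x,p)+N_C(x)$ corresponding to $(\bar v,\bar p)$ if and only if $$\langle\nabla_xf(\bar x,\bar p)w,w\rangle>0\quad\text{for all } w\in L^2(\Omega)\setminus\{0\}\ \text{ with }\ w(y)\big(\bar v(y)-f(\bar x,\bar p)(y)\big)=0\ \text{ a.e. } y\in\Omega.$$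
   Context: $N_C(x)$ is the normal cone of convex analysis ($=\emptyset$ for $x\notin C$). A function $Q\colon X\to\mathbb R$ on a Hilbert space is a Legendre form if it is weakly lower semicontinuous, is of the form $Q(x)=\langle Ax,x\rangle$ with some linear operator $A\colon X\to X$, and satisfies: $x_k\to x$ weakly and $Q(x_k)\to Q(x)$ imply $x_k\to x$ in norm. Assumptions. (A1) There are $L>0$ and a neighborhood $U\times P$ of $(\bar x,\bar p)$ on which $\|f(x_1,p_1)-f(x_2,p_2)\|\le L[\|x_1-x_2\|+d(p_1,p_2)]$. (A4) $f$ is Fréchet differentiable with respect to $x$ around $(\bar x,\bar p)$ uniformly in $p$ (i.e. there is a neighborhood $U\times P$ of $(\bar x,\bar p)$ such that for each $x\in U$ the Fréchet derivative of $f(\cdot,p)$ at $x$ exists for all $p\in P$ with remainder $o(\|h\|)$ uniform in $p$), and $\nabla_xf$ is continuous at $(\bar x,\bar p)$. Full stability. $\bar x$ is a (Lipschitzian) fully stable solution corresponding to $(\bar v,\bar p)$ if there are a neighborhood $V\times P\times U$ of $(\bar v,\bar p,\bar x)$ and a single-valued mapping $\vartheta\colon V\times P\to U$, defined on all of $V\times P$, with $\operatorname{gph}\vartheta=\operatorname{gph}\hat S\cap(V\times P\times U)$, together with $\kappa,\ell>0$ such that for all $(v_1,p_1),(v_2,p_2)\in V\times P$ $$\|(v_1-v_2)-2\kappa[\vartheta(v_1,p_1)-\vartheta(v_2,p_2)]\|\le\|v_1-v_2\|+\ell d(p_1,p_2).$$ *)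

theory Defs
  imports "HOL-Analysis.Analysis"
begin

section \<open>Square-integrable functions\<close>

definition square_integrable :: "('a::euclidean_space \<Rightarrow> real) \<Rightarrow> bool" where
  "square_integrable f \<longleftrightarrow> f \<in> borel_measurable lebesgue \<and> integrable lebesgue (\<lambda>y. (f y)\<^sup>2)"

lemma square_integrable_mult:
  assumes "square_integrable f" "square_integrable g"
  shows "integrable lebesgue (\<lambda>y. f y * g y)"
proof (rule Bochner_Integration.integrable_bound)
  show "integrable lebesgue (\<lambda>y. (f y)\<^sup>2 + (g y)\<^sup>2)"
    using assms by (auto simp: square_integrable_def)
  show "(\<lambda>y. f y * g y) \<in> borel_measurable lebesgue"
    using assms by (auto simp: square_integrable_def)
  have "\<bar>s * t\<bar> \<le> s\<^sup>2 + t\<^sup>2" for s t :: real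
  proof -
    have "0 \<le> (\<bar>s\<bar> - \<bar>t\<bar>)\<^sup>2" "0 \<le> \<bar>s\<bar> * \<bar>t\<bar>" by auto
    then show ?thesis unfolding power2_diff abs_mult power2_abs by linarith
  qed
  then show "AE y in lebesgue. norm (f y * g y) \<le> norm ((f y)\<^sup>2 + (g y)\<^sup>2)" by auto
qed

lemma square_integrable_0 [simp]: "square_integrable (\<lambda>_. 0)"
  by (simp add: square_integrable_def)

lemma square_integrable_add:
  assumes "square_integrable f" "square_integrable g"
  shows "square_integrable (\<lambda>y. f y + g y)"
proof -
  have "integrable lebesgue (\<lambda>y. (f y)\<^sup>2 + (g y)\<^sup>2 + 2 * (f y * g y))"
    using assms square_integrable_mult[OF assms] by (auto simp: square_integrable_def)
  then show ?thesis
    using assms by (auto simp: square_integrable_def power2_sum mult.assoc)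
qed

lemma square_integrable_scale:
  "square_integrable f \<Longrightarrow> square_integrable (\<lambda>y. c * f y)"
  by (auto simp: square_integrable_def power_mult_distrib)

lemma square_integrable_minus:
  "square_integrable f \<Longrightarrow> square_integrable (\<lambda>y. - f y)"
  by (auto simp: square_integrable_def)

lemma square_integrable_diff:
  "square_integrable f \<Longrightarrow> square_integrable g \<Longrightarrow> square_integrable (\<lambda>y. f y - g y)"
  using square_integrable_add[of f "\<lambda>y. - g y"] square_integrable_minus[of g] by simp

section \<open>The Hilbert space of square-integrable functions modulo a.e. equality\<close>

quotient_type (overloaded) 'a l2 = "'a::euclidean_space \<Rightarrow> real" /
  partial: "\<lambda>f g. square_integrable f \<and> square_integrable g \<and> (AE y in lebesgue. f y = g y)"
proof (rule part_equivpI)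
  show "\<exists>f::'a \<Rightarrow> real. square_integrable f \<and> square_integrable f \<and> (AE y in lebesgue. f y = f y)"
    by (rule exI[of _ "\<lambda>_. 0"]) simp
  show "symp (\<lambda>f g::'a \<Rightarrow> real. square_integrable f \<and> square_integrable g \<and> (AE y in lebesgue. f y = g y))"
    by (auto intro!: sympI elim: AE_mp)
  show "transp (\<lambda>f g::'a \<Rightarrow> real. square_integrable f \<and> square_integrable g \<and> (AE y in lebesgue. f y = g y))"
    by (rule transpI) auto
qed

text \<open>An arbitrarily chosen representative of a class; it is meaningful up to null sets only.\<close>

definition l2_fun :: "'a::euclidean_space l2 \<Rightarrow> 'a \<Rightarrow> real" where
  "l2_fun = rep_l2"

lemma square_integrable_l2_fun: "square_integrable (l2_fun x)"
  using Quotient_rep_reflp[OF Quotient_l2, of x] by (simp add: l2_fun_def)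

lemma borel_measurable_l2_fun [measurable]: "l2_fun x \<in> borel_measurable lebesgue"
  using square_integrable_l2_fun[of x] by (simp add: square_integrable_def)

lemma abs_l2_l2_fun [simp]: "abs_l2 (l2_fun x) = x"
  using Quotient_abs_rep[OF Quotient_l2] by (simp add: l2_fun_def)

lemma l2_fun_abs_l2: "square_integrable f \<Longrightarrow> AE y in lebesgue. l2_fun (abs_l2 f) y = f y"
  using Quotient_rep_abs[OF Quotient_l2, of f] by (simp add: l2_fun_def)

lemma l2_eq_iff: "x = z \<longleftrightarrow> (AE y in lebesgue. l2_fun x y = l2_fun z y)"
  using Quotient_rel_rep[OF Quotient_l2, of x z] square_integrable_l2_fun
  by (auto simp: l2_fun_def)

instantiation l2 :: (euclidean_space) real_inner
begin

definition zero_l2 :: "'a l2" where "0 = abs_l2 (\<lambda>_. 0)"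
definition plus_l2 :: "'a l2 \<Rightarrow> 'a l2 \<Rightarrow> 'a l2"
  where "x + z = abs_l2 (\<lambda>y. l2_fun x y + l2_fun z y)"
definition uminus_l2 :: "'a l2 \<Rightarrow> 'a l2" where "- x = abs_l2 (\<lambda>y. - l2_fun x y)"
definition minus_l2 :: "'a l2 \<Rightarrow> 'a l2 \<Rightarrow> 'a l2"
  where "x - z = abs_l2 (\<lambda>y. l2_fun x y - l2_fun z y)"
definition scaleR_l2 :: "real \<Rightarrow> 'a l2 \<Rightarrow> 'a l2"
  where "c *\<^sub>R x = abs_l2 (\<lambda>y. c * l2_fun x y)"
definition inner_l2 :: "'a l2 \<Rightarrow> 'a l2 \<Rightarrow> real"
  where "x \<bullet> z = (\<integral>y. l2_fun x y * l2_fun z y \<partial>lebesgue)"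
definition norm_l2 :: "'a l2 \<Rightarrow> real" where "norm x = sqrt (x \<bullet> (x::'a l2))"
definition sgn_l2 :: "'a l2 \<Rightarrow> 'a l2" where "sgn x = inverse (norm (x::'a l2)) *\<^sub>R x"
definition dist_l2 :: "'a l2 \<Rightarrow> 'a l2 \<Rightarrow> real" where "dist x z = norm (x - z :: 'a l2)"
definition uniformity_l2 :: "('a l2 \<times> 'a l2) filter"
  where "uniformity = (INF e\<in>{0<..}. principal {(x::'a l2, z). dist x z < e})"
definition open_l2 :: "'a l2 set \<Rightarrow> bool"
  where "open U = (\<forall>x\<in>U. eventually (\<lambda>(x', z). x' = x \<longrightarrow> z \<in> U) (uniformity :: ('a l2 \<times> 'a l2) filter))"

lemma l2_fun_0: "AE y in lebesgue. l2_fun (0::'a l2) y = 0"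
  unfolding zero_l2_def by (rule l2_fun_abs_l2) simp

lemma l2_fun_add: "AE y in lebesgue. l2_fun (x + z :: 'a l2) y = l2_fun x y + l2_fun z y"
  unfolding plus_l2_def
  by (rule l2_fun_abs_l2) (intro square_integrable_add square_integrable_l2_fun)

lemma l2_fun_uminus: "AE y in lebesgue. l2_fun (- x :: 'a l2) y = - l2_fun x y"
  unfolding uminus_l2_def
  by (rule l2_fun_abs_l2) (intro square_integrable_minus square_integrable_l2_fun)

lemma l2_fun_diff: "AE y in lebesgue. l2_fun (x - z :: 'a l2) y = l2_fun x y - l2_fun z y"
  unfolding minus_l2_def
  by (rule l2_fun_abs_l2) (intro square_integrable_diff square_integrable_l2_fun)

lemma l2_fun_scaleR: "AE y in lebesgue. l2_fun (c *\<^sub>R x :: 'a l2) y = c * l2_fun x y"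
  unfolding scaleR_l2_def
  by (rule l2_fun_abs_l2) (intro square_integrable_scale square_integrable_l2_fun)

instance
proof
  fix x z w :: "'a l2" and c d :: real
  show "x + z + w = x + (z + w)"
    using l2_fun_add[of "x + z" w] l2_fun_add[of x z] l2_fun_add[of x "z + w"] l2_fun_add[of z w]
    unfolding l2_eq_iff by eventually_elim simp
  show "x + z = z + x"
    using l2_fun_add[of x z] l2_fun_add[of z x] unfolding l2_eq_iff by eventually_elim simp
  show "0 + x = x"
    using l2_fun_add[of 0 x] l2_fun_0 unfolding l2_eq_iff by eventually_elim simp
  show "- x + x = 0"
    using l2_fun_add[of "- x" x] l2_fun_uminus[of x] l2_fun_0
    unfolding l2_eq_iff by eventually_elim simp
  show "x - z = x + - z"
    using l2_fun_diff[of x z] l2_fun_add[of x "- z"] l2_fun_uminus[of z]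
    unfolding l2_eq_iff by eventually_elim simp
  show "c *\<^sub>R (x + z) = c *\<^sub>R x + c *\<^sub>R z"
    using l2_fun_scaleR[of c "x + z"] l2_fun_add[of x z] l2_fun_add[of "c *\<^sub>R x" "c *\<^sub>R z"]
      l2_fun_scaleR[of c x] l2_fun_scaleR[of c z]
    unfolding l2_eq_iff by eventually_elim (simp add: distrib_left)
  show "(c + d) *\<^sub>R x = c *\<^sub>R x + d *\<^sub>R x"
    using l2_fun_scaleR[of "c + d" x] l2_fun_add[of "c *\<^sub>R x" "d *\<^sub>R x"]
      l2_fun_scaleR[of c x] l2_fun_scaleR[of d x]
    unfolding l2_eq_iff by eventually_elim (simp add: distrib_right)
  show "c *\<^sub>R d *\<^sub>R x = (c * d) *\<^sub>R x"
    using l2_fun_scaleR[of c "d *\<^sub>R x"] l2_fun_scaleR[of d x] l2_fun_scaleR[of "c * d" x]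
    unfolding l2_eq_iff by eventually_elim simp
  show "1 *\<^sub>R x = x"
    using l2_fun_scaleR[of 1 x] unfolding l2_eq_iff by eventually_elim simp
  show "dist x z = norm (x - z)" by (fact dist_l2_def)
  show "sgn x = inverse (norm x) *\<^sub>R x" by (fact sgn_l2_def)
  show "uniformity = (INF e\<in>{0<..}. principal {(x::'a l2, z). dist x z < e})"
    by (fact uniformity_l2_def)
  show "open U = (\<forall>x\<in>U. \<forall>\<^sub>F (x', z) in uniformity. x' = x \<longrightarrow> z \<in> U)" for U :: "'a l2 set"
    by (fact open_l2_def)
  show "x \<bullet> z = z \<bullet> x" by (simp add: inner_l2_def mult.commute)
  have int: "integrable lebesgue (\<lambda>y. l2_fun x y * l2_fun z y)" for x z :: "'a l2"
    by (intro square_integrable_mult square_integrable_l2_fun)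
  have "(x + z) \<bullet> w = (\<integral>y. l2_fun x y * l2_fun w y + l2_fun z y * l2_fun w y \<partial>lebesgue)"
    unfolding inner_l2_def
    by (rule integral_cong_AE)
       (use l2_fun_add[of x z] in \<open>auto simp: distrib_right elim: AE_mp\<close>)
  then show "(x + z) \<bullet> w = x \<bullet> w + z \<bullet> w"
    by (simp add: inner_l2_def int)
  have "(c *\<^sub>R x) \<bullet> z = (\<integral>y. c * (l2_fun x y * l2_fun z y) \<partial>lebesgue)"
    unfolding inner_l2_def
    by (rule integral_cong_AE)
       (use l2_fun_scaleR[of c x] in \<open>auto elim: AE_mp\<close>)
  then show "(c *\<^sub>R x) \<bullet> z = c * (x \<bullet> z)"
    by (simp add: inner_l2_def)
  show "0 \<le> x \<bullet> x" by (simp add: inner_l2_def)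
  have "x \<bullet> x = 0 \<longleftrightarrow> (AE y in lebesgue. l2_fun x y * l2_fun x y = 0)"
    unfolding inner_l2_def by (rule integral_nonneg_eq_0_iff_AE) (auto intro: int)
  also have "\<dots> \<longleftrightarrow> x = 0"
    unfolding l2_eq_iff[of x 0] using l2_fun_0 by (auto elim: AE_mp)
  finally show "x \<bullet> x = 0 \<longleftrightarrow> x = 0" .
  show "norm x = sqrt (x \<bullet> x)" by (fact norm_l2_def)
qed

end

lemma integrable_l2_fun_mult: "integrable lebesgue (\<lambda>y. l2_fun x y * l2_fun z y)"
  by (intro square_integrable_mult square_integrable_l2_fun)

lemma norm_l2_power2: "(norm x)\<^sup>2 = (\<integral>y. (l2_fun x y)\<^sup>2 \<partial>lebesgue)"
  unfolding power2_norm_eq_inner inner_l2_def by (simp add: power2_eq_square)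

lemma nn_integral_l2_diff:
  "(\<integral>\<^sup>+y. ennreal ((l2_fun x y - l2_fun z y)\<^sup>2) \<partial>lebesgue) = ennreal ((dist x z)\<^sup>2)"
proof -
  have "(dist x z)\<^sup>2 = (\<integral>y. (l2_fun x y - l2_fun z y)\<^sup>2 \<partial>lebesgue)"
    unfolding dist_norm norm_l2_power2
    by (rule integral_cong_AE) (use l2_fun_diff[of x z] in \<open>auto elim: AE_mp\<close>)
  moreover have "integrable lebesgue (\<lambda>y. (l2_fun x y - l2_fun z y)\<^sup>2)"
    using square_integrable_diff[OF square_integrable_l2_fun square_integrable_l2_fun]
    by (auto simp: square_integrable_def)
  ultimately show ?thesis by (simp add: nn_integral_eq_integral)
qed

instance l2 :: (euclidean_space) complete_space
proof
  fix X :: "nat \<Rightarrow> 'a l2"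
  assume "Cauchy X"
  define F where "F n = l2_fun (X n)" for n
  have [measurable]: "F n \<in> borel_measurable lebesgue" for n by (simp add: F_def)
  have "\<forall>k. \<exists>N. \<forall>m\<ge>N. \<forall>n\<ge>N. dist (X m) (X n) < (1/2)^k"
    using \<open>Cauchy X\<close> by (auto simp: Cauchy_def)
  then obtain N where N: "\<And>k m n. m \<ge> N k \<Longrightarrow> n \<ge> N k \<Longrightarrow> dist (X m) (X n) < (1/2)^k"
    by metis
  define r where "r k = (\<Sum>i\<le>k. N i) + k" for k
  have r_N: "r k \<ge> N k" for k
  proof -
    have "N k \<le> (\<Sum>i\<le>k. N i)" by (rule member_le_sum) auto
    then show ?thesis by (simp add: r_def)
  qed
  have r_mono: "strict_mono r" by (rule strict_monoI_Suc) (simp add: r_def)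
  have r_Suc: "dist (X (r (Suc k))) (X (r k)) < (1/2)^k" for k
    using strict_monoD[OF r_mono, of k "Suc k"] r_N[of k] by (intro N) auto
  define u where "u k y = F (r (Suc k)) y - F (r k) y" for k y
  have [measurable]: "u k \<in> borel_measurable lebesgue" for k unfolding u_def by measurable
  have "(\<integral>\<^sup>+y. (\<Sum>k. ennreal (2^k * (u k y)\<^sup>2)) \<partial>lebesgue)
      = (\<Sum>k. \<integral>\<^sup>+y. ennreal (2^k * (u k y)\<^sup>2) \<partial>lebesgue)"
    by (rule nn_integral_suminf) measurable
  also have "\<dots> \<le> (\<Sum>k. ennreal ((1/2)^k))"
  proof (rule suminf_le)
    fix k
    have "(\<integral>\<^sup>+y. ennreal (2^k * (u k y)\<^sup>2) \<partial>lebesgue) = ennreal (2^k * (dist (X (r (Suc k))) (X (r k)))\<^sup>2)"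
      using nn_integral_l2_diff[of "X (r (Suc k))" "X (r k)"]
      by (simp add: ennreal_mult nn_integral_cmult u_def F_def)
    also have "\<dots> \<le> ennreal (2^k * ((1/2)^k)\<^sup>2)"
      by (intro ennreal_leI mult_left_mono power_mono less_imp_le[OF r_Suc]) auto
    also have "(2::real)^k * ((1/2)^k)\<^sup>2 = (1/2)^k"
      by (simp add: power2_eq_square field_simps)
    finally show "(\<integral>\<^sup>+y. ennreal (2^k * (u k y)\<^sup>2) \<partial>lebesgue) \<le> ennreal ((1/2)^k)" .
  qed auto
  also have "\<dots> = ennreal (\<Sum>k. (1/2)^k)"
    by (rule suminf_ennreal2) (auto intro: summable_geometric)
  also have "\<dots> < \<infinity>" by simp
  finally have "AE y in lebesgue. (\<Sum>k. ennreal (2^k * (u k y)\<^sup>2)) \<noteq> \<infinity>"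
    by (intro nn_integral_PInf_AE) auto
  then have conv: "AE y in lebesgue. convergent (\<lambda>k. F (r k) y)"
  proof eventually_elim
    case (elim y)
    then have 1: "summable (\<lambda>k. 2^k * (u k y)\<^sup>2)"
      by (intro summable_suminf_not_top) auto
    have "summable (\<lambda>k. (1/2)^k + 2^k * (u k y)\<^sup>2)"
      by (intro summable_add 1 summable_geometric) auto
    then have "summable (\<lambda>k. u k y)"
    proof (rule summable_comparison_test'[where N = 0])
      fix k :: nat
      have "\<bar>u k y\<bar> * 2 \<le> (1/2)^k + 2^k * (u k y)\<^sup>2"
      proof -
        have "0 \<le> 2^k * (\<bar>u k y\<bar> - (1/2)^k)\<^sup>2" by simp
        also have "\<dots> = 2^k * (u k y)\<^sup>2 + 2^k * ((1/2)^k)\<^sup>2 - 2 * \<bar>u k y\<bar> * (2^k * (1/2)^k)"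
          by (simp add: power2_diff algebra_simps)
        also have "(2::real)^k * (1/2)^k = 1" by (simp flip: power_mult_distrib)
        also have "(2::real)^k * ((1/2)^k)\<^sup>2 = (1/2)^k"
          by (simp add: power2_eq_square field_simps)
        finally show ?thesis by simp
      qed
      then show "norm (u k y) \<le> (1/2)^k + 2^k * (u k y)\<^sup>2" by simp
    qed
    then have "convergent (\<lambda>n. \<Sum>k<n. u k y)" by (simp add: summable_iff_convergent)
    then have "convergent (\<lambda>n. (\<Sum>k<n. u k y) + F (r 0) y)" by (intro convergent_add convergent_const)
    moreover have "(\<Sum>k<n. u k y) + F (r 0) y = F (r n) y" for n
      unfolding u_def by (subst sum_lessThan_telescope) simp
    ultimately show ?case by simp
  qed
  define g where "g y = lim (\<lambda>k. F (r k) y)" for y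
  have [measurable]: "g \<in> borel_measurable lebesgue"
    unfolding g_def by measurable
  have conv': "AE y in lebesgue. (\<lambda>k. F (r k) y) \<longlonglongrightarrow> g y"
    using conv by eventually_elim (simp add: g_def convergent_LIMSEQ_iff)
  have fatou: "(\<integral>\<^sup>+y. ennreal ((g y - F n y)\<^sup>2) \<partial>lebesgue) \<le> ennreal (((1/2)^j)\<^sup>2)"
    if "n \<ge> N j" for n j
  proof -
    have "(\<integral>\<^sup>+y. ennreal ((g y - F n y)\<^sup>2) \<partial>lebesgue)
        = (\<integral>\<^sup>+y. liminf (\<lambda>k. ennreal ((F (r k) y - F n y)\<^sup>2)) \<partial>lebesgue)"
    proof (rule nn_integral_cong_AE)
      show "AE y in lebesgue. ennreal ((g y - F n y)\<^sup>2) = liminf (\<lambda>k. ennreal ((F (r k) y - F n y)\<^sup>2))"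
        using conv'
      proof eventually_elim
        case (elim y)
        then have "(\<lambda>k. ennreal ((F (r k) y - F n y)\<^sup>2)) \<longlonglongrightarrow> ennreal ((g y - F n y)\<^sup>2)"
          by (intro tendsto_ennrealI tendsto_intros)
        from lim_imp_Liminf[OF sequentially_bot this] show ?case by (rule sym)
      qed
    qed
    also have "\<dots> \<le> liminf (\<lambda>k. \<integral>\<^sup>+y. ennreal ((F (r k) y - F n y)\<^sup>2) \<partial>lebesgue)"
      by (rule nn_integral_liminf) measurable
    also have "\<dots> = liminf (\<lambda>k. ennreal ((dist (X (r k)) (X n))\<^sup>2))"
      by (simp add: F_def nn_integral_l2_diff)
    also have "\<dots> \<le> liminf (\<lambda>k. ennreal (((1/2)^j)\<^sup>2))"
    proof (rule Liminf_mono)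
      have "\<forall>\<^sub>F k in sequentially. k \<ge> N j" by (rule eventually_ge_at_top)
      then show "\<forall>\<^sub>F k in sequentially. ennreal ((dist (X (r k)) (X n))\<^sup>2) \<le> ennreal (((1/2)^j)\<^sup>2)"
      proof eventually_elim
        case (elim k)
        then have "r k \<ge> N j" by (simp add: r_def)
        then show ?case using N[of j "r k" n] that
          by (intro ennreal_leI power_mono) auto
      qed
    qed
    also have "\<dots> = ennreal (((1/2)^j)\<^sup>2)" by (simp add: Liminf_const)
    finally show ?thesis .
  qed
  have "square_integrable (\<lambda>y. g y - F (N 0) y)"
    unfolding square_integrable_def
  proof (intro conjI integrableI_bounded)
    show "(\<integral>\<^sup>+ y. ennreal (norm ((g y - F (N 0) y)\<^sup>2)) \<partial>lebesgue) < \<infinity>"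
      using fatou[of 0 "N 0"] by (simp add: order_le_less_trans)
  qed measurable
  then have "square_integrable (\<lambda>y. (g y - F (N 0) y) + F (N 0) y)"
    unfolding F_def by (intro square_integrable_add square_integrable_l2_fun)
  then have g: "square_integrable g" by simp
  have bound: "dist (abs_l2 g) (X n) \<le> (1/2)^j" if "n \<ge> N j" for n j
  proof -
    have "ennreal ((dist (abs_l2 g) (X n))\<^sup>2) = (\<integral>\<^sup>+y. ennreal ((g y - F n y)\<^sup>2) \<partial>lebesgue)"
      unfolding nn_integral_l2_diff[symmetric]
      by (rule nn_integral_cong_AE) (use l2_fun_abs_l2[OF g] in \<open>auto simp: F_def elim: AE_mp\<close>)
    also have "\<dots> \<le> ennreal (((1/2)^j)\<^sup>2)" by (rule fatou[OF that])
    finally have "(dist (abs_l2 g) (X n))\<^sup>2 \<le> ((1/2)^j)\<^sup>2"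
      by (subst (asm) ennreal_le_iff) auto
    then show ?thesis by (rule power2_le_imp_le) simp
  qed
  have "X \<longlonglongrightarrow> abs_l2 g"
  proof (rule metric_LIMSEQ_I)
    fix e :: real assume "e > 0"
    then obtain j where "(1/2)^j < e" using real_arch_pow_inv[of e "1/2"] by auto
    then show "\<exists>no. \<forall>n\<ge>no. dist (X n) (abs_l2 g) < e"
      using bound by (metis dist_commute order_le_less_trans)
  qed
  then show "convergent X" by (rule convergentI)
qed

text \<open>
  The space of square-integrable functions on \<open>\<Omega>\<close>, realised through extension by zero as a closed
  subspace. The three lemmas that follow the definition justify this: restriction to \<open>\<Omega>\<close> is an
  isometric bijection onto the square-integrable functions on \<open>\<Omega>\<close> modulo a.e. equality on \<open>\<Omega>\<close>.
\<close>

definition L2 :: "'a::euclidean_space set \<Rightarrow> 'a l2 set" where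
  "L2 \<Omega> = {x. AE y in lebesgue. y \<notin> \<Omega> \<longrightarrow> l2_fun x y = 0}"

lemma L2_surj:
  assumes "\<Omega> \<in> sets lebesgue"
    and "g \<in> borel_measurable (lebesgue_on \<Omega>)" "integrable (lebesgue_on \<Omega>) (\<lambda>y. (g y)\<^sup>2)"
  shows "\<exists>x\<in>L2 \<Omega>. AE y in lebesgue_on \<Omega>. l2_fun x y = g y"
proof
  let ?h = "\<lambda>y. if y \<in> \<Omega> then g y else 0"
  have eq: "(\<lambda>y. (?h y)\<^sup>2) = (\<lambda>y. indicator \<Omega> y *\<^sub>R (g y)\<^sup>2)"
    by (auto simp: fun_eq_iff)
  have "square_integrable ?h"
    unfolding square_integrable_def eq
    using assms by (auto simp: integrable_restrict_space borel_measurable_if)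
  from l2_fun_abs_l2[OF this]
  show "abs_l2 ?h \<in> L2 \<Omega>" "AE y in lebesgue_on \<Omega>. l2_fun (abs_l2 ?h) y = g y"
    unfolding L2_def using assms(1) by (auto simp: AE_restrict_space_iff elim: AE_mp)
qed

lemma L2_eq_iff:
  assumes "\<Omega> \<in> sets lebesgue" "x \<in> L2 \<Omega>" "z \<in> L2 \<Omega>"
  shows "x = z \<longleftrightarrow> (AE y in lebesgue_on \<Omega>. l2_fun x y = l2_fun z y)"
proof -
  have "(AE y in lebesgue. l2_fun x y = l2_fun z y)
      \<longleftrightarrow> (AE y in lebesgue. y \<in> \<Omega> \<longrightarrow> l2_fun x y = l2_fun z y)"
  proof
    assume "AE y in lebesgue. y \<in> \<Omega> \<longrightarrow> l2_fun x y = l2_fun z y"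
    moreover have "AE y in lebesgue. y \<notin> \<Omega> \<longrightarrow> l2_fun x y = 0"
      "AE y in lebesgue. y \<notin> \<Omega> \<longrightarrow> l2_fun z y = 0"
      using assms by (auto simp: L2_def)
    ultimately show "AE y in lebesgue. l2_fun x y = l2_fun z y" by eventually_elim auto
  qed (auto elim: AE_mp)
  then show ?thesis using assms(1) by (simp add: l2_eq_iff AE_restrict_space_iff)
qed

lemma L2_inner:
  assumes "\<Omega> \<in> sets lebesgue" "x \<in> L2 \<Omega>"
  shows "x \<bullet> z = (\<integral>y. l2_fun x y * l2_fun z y \<partial>lebesgue_on \<Omega>)"
proof -
  have "x \<bullet> z = (\<integral>y. indicator \<Omega> y *\<^sub>R (l2_fun x y * l2_fun z y) \<partial>lebesgue)"
    unfolding inner_l2_def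
    by (rule integral_cong_AE)
       (use assms in \<open>auto simp: L2_def indicator_def elim!: AE_mp\<close>)
  then show ?thesis using assms(1) by (simp add: integral_restrict_space)
qed

lemma subspace_L2: "subspace (L2 \<Omega>)"
  unfolding subspace_def
proof (intro conjI ballI allI)
  show "0 \<in> L2 \<Omega>" using l2_fun_0 unfolding L2_def by (auto elim: AE_mp)
  fix x z :: "'a l2" and c :: real
  assume "x \<in> L2 \<Omega>"
  then have x: "AE y in lebesgue. y \<notin> \<Omega> \<longrightarrow> l2_fun x y = 0" by (simp add: L2_def)
  show "c *\<^sub>R x \<in> L2 \<Omega>"
    unfolding L2_def mem_Collect_eq using x l2_fun_scaleR[of c x] by eventually_elim auto
  assume "z \<in> L2 \<Omega>"
  then have z: "AE y in lebesgue. y \<notin> \<Omega> \<longrightarrow> l2_fun z y = 0" by (simp add: L2_def)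
  show "x + z \<in> L2 \<Omega>"
    unfolding L2_def mem_Collect_eq using x z l2_fun_add[of x z] by eventually_elim auto
qed

lemma closed_L2:
  assumes "\<Omega> \<in> sets lebesgue"
  shows "closed (L2 \<Omega>)"
proof -
  have "L2 \<Omega> = (\<Inter>z \<in> L2 (- \<Omega>). {x. x \<bullet> z = 0})"
  proof (intro equalityI subsetI INT_I)
    fix x z assume "x \<in> L2 \<Omega>" "z \<in> L2 (- \<Omega>)"
    then have "AE y in lebesgue. l2_fun x y * l2_fun z y = 0"
      unfolding L2_def by (auto elim: AE_mp)
    then have "x \<bullet> z = (\<integral>y. 0 \<partial>(lebesgue :: 'a measure))"
      unfolding inner_l2_def by (intro integral_cong_AE) auto
    then show "x \<in> {x. x \<bullet> z = 0}" by simp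
  next
    fix x assume *: "x \<in> (\<Inter>z \<in> L2 (- \<Omega>). {x. x \<bullet> z = 0})"
    have m: "- \<Omega> \<in> sets lebesgue"
      using sets.compl_sets[OF assms] by (simp add: Compl_eq_Diff_UNIV)
    have sq: "integrable lebesgue (\<lambda>y. (l2_fun x y)\<^sup>2)"
      using square_integrable_l2_fun[of x] by (simp add: square_integrable_def)
    have "integrable lebesgue (\<lambda>y. indicator (- \<Omega>) y *\<^sub>R (l2_fun x y)\<^sup>2)"
      by (rule integrable_mult_indicator[OF m sq])
    then obtain z where z: "z \<in> L2 (- \<Omega>)" "AE y in lebesgue_on (- \<Omega>). l2_fun z y = l2_fun x y"
      using L2_surj[OF m, of "l2_fun x"] m borel_measurable_l2_fun[of x]
      by (auto simp: integrable_restrict_space measurable_restrict_space1)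
    have "z \<bullet> z = z \<bullet> x"
      unfolding L2_inner[OF m z(1)]
      by (rule integral_cong_AE)
         (use z(2) borel_measurable_l2_fun in \<open>auto simp: measurable_restrict_space1 elim: AE_mp\<close>)
    also have "\<dots> = 0" using * z(1) by (auto simp: inner_commute)
    finally have "z = 0" by simp
    then show "x \<in> L2 \<Omega>"
      using z(2) l2_fun_0 m unfolding L2_def
      by (auto simp: AE_restrict_space_iff elim: AE_mp)
  qed
  moreover have "closed {x. x \<bullet> z = 0}" for z :: "'a l2"
    by (intro closed_Collect_eq continuous_intros)
  ultimately show ?thesis by auto
qed

section \<open>Variational notions in a Hilbert space\<close>

text \<open>
  The Hilbert space under consideration is a closed subspace \<open>X\<close> of a type, and all notions are
  relative to \<open>X\<close>. Maps on \<open>X\<close> are represented by functions on the type, of which only the values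
  on \<open>X\<close> matter.
\<close>

definition nbhd_in :: "'a::topological_space set \<Rightarrow> 'a \<Rightarrow> 'a set \<Rightarrow> bool" where
  "nbhd_in X x U \<longleftrightarrow> U \<subseteq> X \<and> (\<exists>T. openin (top_of_set X) T \<and> x \<in> T \<and> T \<subseteq> U)"

definition normal_cone :: "'x::real_inner set \<Rightarrow> 'x set \<Rightarrow> 'x \<Rightarrow> 'x set" where
  "normal_cone X C x = (if x \<in> C then {v \<in> X. \<forall>c\<in>C. v \<bullet> (c - x) \<le> 0} else {})"

definition solution_map ::
  "'x::real_inner set \<Rightarrow> 'x set \<Rightarrow> ('x \<Rightarrow> 'p \<Rightarrow> 'x) \<Rightarrow> 'x \<Rightarrow> 'p \<Rightarrow> 'x set" where
  "solution_map X C f v p = {x \<in> X. v \<in> (\<lambda>u. f x p + u) ` normal_cone X C x}"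

text \<open>
  The initial topology of the functionals \<open>\<lambda>x. x \<bullet> y\<close>, i.e. the pullback of the product topology.
  Letting \<open>y\<close> range over the whole type instead of \<open>X\<close> makes no difference, since on \<open>X\<close> the
  functional of \<open>y\<close> is that of the orthogonal projection of \<open>y\<close> to \<open>X\<close>.
\<close>

definition weak_topology :: "'x::real_inner set \<Rightarrow> 'x topology" where
  "weak_topology X = pullback_topology X (\<lambda>x y. x \<bullet> y) euclidean"

definition weakly_lsc :: "'x::real_inner set \<Rightarrow> ('x \<Rightarrow> real) \<Rightarrow> bool" where
  "weakly_lsc X Q \<longleftrightarrow> (\<forall>\<alpha>. closedin (weak_topology X) {x \<in> X. Q x \<le> \<alpha>})"

definition legendre_form :: "'x::real_inner set \<Rightarrow> ('x \<Rightarrow> real) \<Rightarrow> bool" where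
  "legendre_form X Q \<longleftrightarrow>
     weakly_lsc X Q \<and>
     (\<exists>A. linear A \<and> A ` X \<subseteq> X \<and> (\<forall>x\<in>X. Q x = A x \<bullet> x)) \<and>
     (\<forall>s x. range s \<subseteq> X \<and> x \<in> X \<and> limitin (weak_topology X) s x sequentially
        \<and> (\<lambda>k. Q (s k)) \<longlonglongrightarrow> Q x \<longrightarrow> s \<longlonglongrightarrow> x)"

definition locally_lipschitz_at ::
  "'x::real_inner set \<Rightarrow> ('x \<Rightarrow> 'p::metric_space \<Rightarrow> 'x) \<Rightarrow> 'x \<Rightarrow> 'p \<Rightarrow> bool" where
  "locally_lipschitz_at X f xb pb \<longleftrightarrow>
     (\<exists>L>0. \<exists>U P. nbhd_in X xb U \<and> nbhd_in UNIV pb P \<and>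
        (\<forall>x1\<in>U. \<forall>x2\<in>U. \<forall>p1\<in>P. \<forall>p2\<in>P.
           norm (f x1 p1 - f x2 p2) \<le> L * (norm (x1 - x2) + dist p1 p2)))"

text \<open>
  \<open>D x p\<close> is the partial derivative of \<open>f\<close> with respect to \<open>x\<close>, so that it is determined on \<open>X\<close> for
  \<open>(x, p)\<close> close to the reference point. The last conjunct is continuity of \<open>D\<close> in the operator norm
  of maps from \<open>X\<close> to \<open>X\<close>.
\<close>

definition uniformly_frechet_at ::
  "'x::real_inner set \<Rightarrow> ('x \<Rightarrow> 'p::metric_space \<Rightarrow> 'x) \<Rightarrow> ('x \<Rightarrow> 'p \<Rightarrow> 'x \<Rightarrow> 'x) \<Rightarrow> 'x \<Rightarrow> 'p \<Rightarrow> bool" where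
  "uniformly_frechet_at X f D xb pb \<longleftrightarrow>
     (\<exists>U P. nbhd_in X xb U \<and> nbhd_in UNIV pb P \<and>
        (\<forall>x\<in>U. (\<forall>p\<in>P. ((\<lambda>z. f z p) has_derivative D x p) (at x within X)) \<and>
           (\<forall>\<epsilon>>0. \<exists>\<delta>>0. \<forall>p\<in>P. \<forall>h\<in>X. norm h < \<delta> \<longrightarrow>
              norm (f (x + h) p - f x p - D x p h) \<le> \<epsilon> * norm h))) \<and>
     (\<forall>\<epsilon>>0. \<exists>\<delta>>0. \<forall>x\<in>X. \<forall>p. norm (x - xb) < \<delta> \<and> dist p pb < \<delta> \<longrightarrow>
        (\<forall>w\<in>X. norm (D x p w - D xb pb w) \<le> \<epsilon> * norm w))"

definition fully_stable ::
  "'x::real_inner set \<Rightarrow> ('x \<Rightarrow> 'p::metric_space \<Rightarrow> 'x set) \<Rightarrow> 'x \<Rightarrow> 'p \<Rightarrow> 'x \<Rightarrow> bool" where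
  "fully_stable X S vb pb xb \<longleftrightarrow>
     (\<exists>V P U. nbhd_in X vb V \<and> nbhd_in UNIV pb P \<and> nbhd_in X xb U \<and>
       (\<exists>\<theta>. (\<forall>v\<in>V. \<forall>p\<in>P. \<theta> v p \<in> U) \<and>
          {(v, p, x). v \<in> V \<and> p \<in> P \<and> x = \<theta> v p} = {(v, p, x). x \<in> S v p} \<inter> V \<times> P \<times> U \<and>
          (\<exists>\<kappa>>0. \<exists>l>0. \<forall>v1\<in>V. \<forall>v2\<in>V. \<forall>p1\<in>P. \<forall>p2\<in>P.
             norm ((v1 - v2) - (2 * \<kappa>) *\<^sub>R (\<theta> v1 p1 - \<theta> v2 p2)) \<le> norm (v1 - v2) + l * dist p1 p2)))"

definition box_constraint ::
  "'a::euclidean_space set \<Rightarrow> ereal \<Rightarrow> ereal \<Rightarrow> 'a l2 set" where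
  "box_constraint \<Omega> a b =
     {x \<in> L2 \<Omega>. AE y in lebesgue_on \<Omega>. a \<le> ereal (l2_fun x y) \<and> ereal (l2_fun x y) \<le> b}"

end

theory Submission
  imports Defs "HOL-Library.Diagonal_Subsequence"
begin

text \<open>
  Write \<open>A\<close> for the derivative at the reference point, \<open>Q\<close> for its quadratic form, \<open>C\<close> for the
  constraint set, \<open>N\<close> for its normal cone mapping and \<open>u = vb - f xb pb\<close>, which is a normal to \<open>C\<close> at \<open>xb\<close>. A direction
  \<open>w\<close> is critical if \<open>u w = 0\<close> almost everywhere. Sufficiency of positivity for full stability passes
  through the property \<open>locally_strongly_monotone\<close>: for \<open>p\<close> near \<open>pb\<close> the
  mapping \<open>f(\<cdot>, p) + N\<close> is strongly monotone along pairs \<open>(x, u')\<close> in the graph of \<open>N\<close> that are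
  close to \<open>(xb, u)\<close>.

  Positivity on the critical subspace implies this property. Otherwise there are pairs \<open>x1, x2\<close> with
  normals \<open>u1, u2\<close> that violate it with constants tending to zero. Their normalised differences
  \<open>w k\<close> have a weakly convergent subsequence with limit \<open>w\<close>. Since the normal cone acts pointwise,
  \<open>u1\<close> and \<open>w k\<close> have the same sign almost everywhere, so \<open>\<integral> \<bar>u1 w k\<bar>\<close> is the inner product of
  \<open>u1\<close> and \<open>w k\<close>, which the violated inequality forces to zero. Hence \<open>u w = 0\<close> and \<open>w\<close> is critical.
  Weak lower semicontinuity gives \<open>Q w \<le> 0\<close>, so \<open>w = 0\<close>; now \<open>Q (w k)\<close> converges to \<open>0 = Q 0\<close>,
  and the Legendre property makes the unit vectors \<open>w k\<close> converge to \<open>0\<close> in norm, which is absurd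
  (\<open>legendre_form_local_growth\<close>).

  Local strong monotonicity implies full stability. The estimate and uniqueness are immediate
  computations; existence is the point, because the property says nothing about points of the graph
  that are far from the reference point. It is obtained by continuation: for
  \<open>f(x, p) + t (x - xb) + N(x)\<close> with large \<open>t\<close> the solution is a fixed point of a contraction
  built from the projection to \<open>C\<close>; the strong monotonicity modulus does not deteriorate when
  \<open>t\<close> decreases to \<open>0\<close>, so finitely many contraction steps of a fixed length lead down to
  \<open>t = 0\<close> (\<open>fully_stable_if_locally_strongly_monotone\<close>).

  Conversely, full stability makes solutions depend on \<open>v\<close> in a strongly monotone way. A bounded
  critical direction \<open>w\<close> is, up to a small factor \<open>t\<close>, the difference of two points of \<open>C\<close> near \<open>xb\<close>
  that agree with \<open>xb\<close> wherever \<open>w = 0\<close>, so that \<open>u\<close> is normal to \<open>C\<close> at both of them. Monotonicity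
  at these two points is a quadratic lower bound for \<open>Q w\<close>; truncation removes the boundedness of
  \<open>w\<close> (\<open>fully_stable_imp_coercive_on_critical\<close>).
\<close>

section \<open>Projection, Riesz representation and weak compactness\<close>

text \<open>
  A minimiser of \<open>x \<bullet> x - 2 l x\<close> exists because minimising sequences are Cauchy by the parallelogram
  law, and its first-order condition is the variational inequality. The case of an inner product
  \<open>l\<close> is the metric projection; the case of a subspace \<open>S\<close> is the Riesz representation theorem.
\<close>

lemma variational_inequality_solvable:
  fixes S :: "'x::{real_inner,complete_space} set"
  assumes "closed S" "convex S" "S \<noteq> {}" and "bounded_linear l"
  shows "\<exists>x\<in>S. \<forall>c\<in>S. l (c - x) \<le> x \<bullet> (c - x)"
proof -
  interpret l: bounded_linear l by fact
  obtain K where K: "\<And>x. norm (l x) \<le> norm x * K" using l.bounded by auto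
  define J where "J x = x \<bullet> x - 2 * l x" for x
  have low: "- K\<^sup>2 \<le> J x" for x
  proof -
    have "l x \<le> norm x * K" using K[of x] by simp
    moreover have "0 \<le> (norm x - K)\<^sup>2" by simp
    ultimately show ?thesis
      unfolding J_def power2_norm_eq_inner[symmetric] by (simp add: power2_diff)
  qed
  define m where "m = (INF x\<in>S. J x)"
  have bdd: "bdd_below (J ` S)" by (rule bdd_belowI2) (rule low)
  have m_le: "m \<le> J x" if "x \<in> S" for x
    unfolding m_def using bdd that by (rule cINF_lower)
  have "\<exists>x\<in>S. J x < m + 1 / real (Suc n)" for n
    using cINF_less_iff[OF \<open>S \<noteq> {}\<close> bdd, of "m + 1 / real (Suc n)"] unfolding m_def by simp
  then obtain s where s: "\<And>n. s n \<in> S" "\<And>n. J (s n) < m + 1 / real (Suc n)"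
    by metis
  have parallelogram: "(norm (x - y))\<^sup>2 = 2 * J x + 2 * J y - 4 * J ((1/2) *\<^sub>R x + (1/2) *\<^sub>R y)" for x y
    unfolding J_def power2_norm_eq_inner
    by (simp add: inner_simps l.add l.scaleR inner_commute)
  have close: "(dist (s i) (s j))\<^sup>2 \<le> 2 / real (Suc i) + 2 / real (Suc j)" for i j
  proof -
    have "(1/2) *\<^sub>R s i + (1/2) *\<^sub>R s j \<in> S"
      using s \<open>convex S\<close> by (intro convexD) auto
    from m_le[OF this] show ?thesis
      using s(2)[of i] s(2)[of j] unfolding dist_norm parallelogram by simp
  qed
  have "Cauchy s"
  proof (rule metric_CauchyI)
    fix e :: real assume "0 < e"
    then obtain N where N: "4 / real (Suc N) < e\<^sup>2"
      using reals_Archimedean[of "e\<^sup>2 / 4"]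
      by (auto simp: field_simps)
    have "dist (s i) (s j) < e" if "N \<le> i" "N \<le> j" for i j
    proof -
      have "2 / real (Suc i) \<le> 2 / real (Suc N)" "2 / real (Suc j) \<le> 2 / real (Suc N)"
        using that by (auto intro!: divide_left_mono)
      then have "(dist (s i) (s j))\<^sup>2 < e\<^sup>2" using close[of i j] N by simp
      then show ?thesis using \<open>0 < e\<close> by (simp add: power2_less_imp_less)
    qed
    then show "\<exists>M. \<forall>m\<ge>M. \<forall>n\<ge>M. dist (s m) (s n) < e" by blast
  qed
  then obtain x where x: "s \<longlonglongrightarrow> x" using Cauchy_convergent convergent_def by blast
  have "x \<in> S" using closed_sequentially[OF \<open>closed S\<close> _ x] s by blast
  have "(\<lambda>n. J (s n)) \<longlonglongrightarrow> J x" unfolding J_def by (intro tendsto_intros l.tendsto x)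
  moreover have "(\<lambda>n. m + 1 / real (Suc n)) \<longlonglongrightarrow> m + 0"
    by (intro tendsto_intros lim_inverse_n' LIMSEQ_Suc)
  ultimately have "J x \<le> m + 0"
    by (rule LIMSEQ_le) (use s(2) less_imp_le in blast)
  then have min: "J x \<le> J z" if "z \<in> S" for z using m_le[OF that] by simp
  have "l (c - x) \<le> x \<bullet> (c - x)" if "c \<in> S" for c
  proof -
    define q where "q = x \<bullet> (c - x) - l (c - x)"
    have ineq: "0 \<le> 2 * q + (1 / real (Suc n)) * (norm (c - x))\<^sup>2" for n
    proof -
      define t where "t = 1 / real (Suc n)"
      have t: "0 < t" "t \<le> 1" by (auto simp: t_def)
      have "x + t *\<^sub>R (c - x) = (1 - t) *\<^sub>R x + t *\<^sub>R c" by (simp add: algebra_simps)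
      also have "\<dots> \<in> S" using \<open>convex S\<close> \<open>x \<in> S\<close> that t by (intro convexD) auto
      finally have "J x \<le> J (x + t *\<^sub>R (c - x))" by (rule min)
      also have "\<dots> = J x + t * (2 * q + t * (norm (c - x))\<^sup>2)"
      proof -
        have "J (x + t *\<^sub>R d) = J x + t * (2 * (x \<bullet> d - l d) + t * (norm d)\<^sup>2)" for d
          unfolding J_def power2_norm_eq_inner l.add l.scaleR
          by (simp add: inner_add_left inner_add_right inner_commute[of d x] algebra_simps)
        then show ?thesis by (simp add: q_def)
      qed
      finally have "0 \<le> t * (2 * q + t * (norm (c - x))\<^sup>2)" by simp
      then show ?thesis using t(1) unfolding t_def[symmetric] by (simp add: zero_le_mult_iff)
    qed
    have "(\<lambda>n. 2 * q + (1 / real (Suc n)) * (norm (c - x))\<^sup>2) \<longlonglongrightarrow> 2 * q + 0 * (norm (c - x))\<^sup>2"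
      by (intro tendsto_intros lim_inverse_n' LIMSEQ_Suc)
    from LIMSEQ_le_const[OF this] ineq have "0 \<le> 2 * q" by auto
    then show ?thesis by (simp add: q_def)
  qed
  then show ?thesis using \<open>x \<in> S\<close> by blast
qed

lemma projection_exists:
  fixes S :: "'x::{real_inner,complete_space} set"
  assumes "closed S" "convex S" "S \<noteq> {}"
  shows "\<exists>x\<in>S. \<forall>c\<in>S. (a - x) \<bullet> (c - x) \<le> 0"
  using variational_inequality_solvable[OF assms bounded_linear_inner_right[of a]]
  by (simp add: inner_diff_left)

lemma subspace_variational_equality:
  assumes "subspace Y" "x \<in> Y" "linear l" "\<forall>c\<in>Y. l (c - x) \<le> x \<bullet> (c - x)" "y \<in> Y"
  shows "l y = x \<bullet> y"
proof (rule antisym)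
  have "x + y \<in> Y" "x - y \<in> Y" using assms by (auto intro: subspace_add subspace_diff)
  from this[THEN assms(4)[rule_format]] show "l y \<le> x \<bullet> y" "x \<bullet> y \<le> l y"
    using assms(3) by (auto simp: linear_neg)
qed

text \<open>
  A diagonal argument makes the inner products with all members of the sequence converge. The vectors
  \<open>z\<close> for which they converge form a closed subspace, which intersected with \<open>X\<close> still contains the
  sequence; projecting to this intersection extends convergence to every \<open>z\<close>, and the limit
  functional is represented by a vector of it.
\<close>

lemma bounded_imp_weakly_convergent_subsequence:
  fixes s :: "nat \<Rightarrow> 'x::{real_inner,complete_space}"
  assumes "subspace X" "closed X" "range s \<subseteq> X" "bounded (range s)"
  shows "\<exists>x\<in>X. \<exists>r. strict_mono r \<and> (\<forall>z. (\<lambda>k. s (r k) \<bullet> z) \<longlonglongrightarrow> x \<bullet> z)"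
proof -
  obtain K where K: "\<And>k. norm (s k) \<le> K" using assms(4) by (auto simp: bounded_iff)
  interpret subseqs "\<lambda>n r. convergent (\<lambda>k. s (r k) \<bullet> s n)"
  proof
    fix n and r :: "nat \<Rightarrow> nat"
    have "norm (s (r k) \<bullet> s n) \<le> K * K" for k
      using Cauchy_Schwarz_ineq2[of "s (r k)" "s n"] K[of "r k"] K[of n]
      by (simp add: order_trans mult_mono' norm_ge_zero)
    then have "bounded (range (\<lambda>k. s (r k) \<bullet> s n))" by (auto simp: bounded_iff)
    then obtain q l where "strict_mono q" "((\<lambda>k. s (r k) \<bullet> s n) \<circ> q) \<longlonglongrightarrow> l"
      using bounded_imp_convergent_subsequence by blast
    then show "\<exists>r'. strict_mono r' \<and> convergent (\<lambda>k. s ((r \<circ> r') k) \<bullet> s n)"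
      by (auto simp: o_def convergent_def)
  qed
  define t where "t k = s (diagseq k)" for k
  have t_K: "norm (t k) \<le> K" for k using K by (simp add: t_def)
  have "convergent (\<lambda>k. s ((diagseq \<circ> (+) (Suc n)) k) \<bullet> s n)" for n
  proof (rule diagseq_holds)
    fix r q :: "nat \<Rightarrow> nat" and n
    assume "strict_mono r" "convergent (\<lambda>k. s (q k) \<bullet> s n)"
    from convergent_subseq_convergent[OF this(2,1)]
    show "convergent (\<lambda>k. s ((q \<circ> r) k) \<bullet> s n)" by (simp add: o_def)
  qed
  then have "convergent (\<lambda>k. t (k + Suc n) \<bullet> s n)" for n
    unfolding t_def o_def by (simp only: add.commute[of _ "Suc n"])
  then have conv_s: "convergent (\<lambda>k. t k \<bullet> s n)" for n
    using convergent_ignore_initial_segment[of "\<lambda>k. t k \<bullet> s n" "Suc n"] by blast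
  define Z where "Z = {z. convergent (\<lambda>k. t k \<bullet> z)}"
  have Z: "subspace Z"
    unfolding subspace_def Z_def
    by (auto simp: inner_add_right convergent_const intro: convergent_add convergent_mult)
  have "closed Z"
    unfolding closure_subset_eq[symmetric]
  proof
    fix y assume y: "y \<in> closure Z"
    have "Cauchy (\<lambda>k. t k \<bullet> y)"
    proof (rule metric_CauchyI)
      fix e :: real assume "0 < e"
      have K0: "0 \<le> K" using K[of 0] norm_ge_zero order_trans by blast
      define d where "d = e / (3 * (K + 1))"
      have d: "0 < d" "K * d \<le> e / 3" using \<open>0 < e\<close> K0 by (auto simp: d_def field_simps)
      obtain z where z: "z \<in> Z" "dist z y < d"
        using y d unfolding closure_approachable by blast
      then have "Cauchy (\<lambda>k. t k \<bullet> z)" using z by (auto simp: Z_def intro: convergent_Cauchy)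
      then obtain M where M: "\<And>m n. m \<ge> M \<Longrightarrow> n \<ge> M \<Longrightarrow> dist (t m \<bullet> z) (t n \<bullet> z) < e / 3"
        using \<open>0 < e\<close> metric_CauchyD[of "\<lambda>k. t k \<bullet> z" "e/3"] by auto
      have near: "dist (t k \<bullet> y) (t k \<bullet> z) \<le> e / 3" for k
      proof -
        have "dist (t k \<bullet> y) (t k \<bullet> z) = \<bar>t k \<bullet> (y - z)\<bar>" by (simp add: dist_real_def inner_diff_right)
        also have "\<dots> \<le> norm (t k) * norm (y - z)" by (rule Cauchy_Schwarz_ineq2)
        also have "\<dots> \<le> K * d"
          using t_K[of k] z(2) K0 by (intro mult_mono) (auto simp: dist_norm norm_minus_commute)
        finally show ?thesis using d by simp
      qed
      have "dist (t m \<bullet> y) (t n \<bullet> y) < e" if "m \<ge> M" "n \<ge> M" for m n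
        using M[OF that] near[of m] near[of n] unfolding dist_real_def by linarith
      then show "\<exists>M. \<forall>m\<ge>M. \<forall>n\<ge>M. dist (t m \<bullet> y) (t n \<bullet> y) < e" by blast
    qed
    then show "y \<in> Z" by (simp add: Z_def Cauchy_convergent)
  qed
  define Y where "Y = X \<inter> Z"
  have Y: "subspace Y" "closed Y" and YX: "Y \<subseteq> X" and YZ: "Y \<subseteq> Z"
    using assms Z \<open>closed Z\<close> by (auto simp: Y_def intro: subspace_inter)
  have split: "\<exists>p\<in>Y. \<forall>y\<in>Y. z \<bullet> y = p \<bullet> y" for z
  proof -
    obtain p where p: "p \<in> Y" "\<forall>c\<in>Y. z \<bullet> (c - p) \<le> p \<bullet> (c - p)"
      using projection_exists[of Y z] Y subspace_imp_convex[of Y] subspace_0[of Y]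
      by (auto simp: inner_diff_left)
    have "\<forall>y\<in>Y. z \<bullet> y = p \<bullet> y"
      using subspace_variational_equality[OF Y(1) p(1) _ p(2)]
      by (simp add: bounded_linear.linear bounded_linear_inner_right)
    with p(1) show ?thesis by blast
  qed
  have tY: "t k \<in> Y" for k
    using assms(3) conv_s by (auto simp: Y_def Z_def t_def)
  have conv: "convergent (\<lambda>k. t k \<bullet> z)" for z
  proof -
    obtain p where p: "p \<in> Y" "\<forall>y\<in>Y. z \<bullet> y = p \<bullet> y" using split by blast
    then have "(\<lambda>k. t k \<bullet> z) = (\<lambda>k. t k \<bullet> p)" using tY by (simp add: inner_commute[of "t _"])
    then show ?thesis using YZ p by (auto simp: Z_def)
  qed
  define l where "l z = lim (\<lambda>k. t k \<bullet> z)" for z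
  have l: "(\<lambda>k. t k \<bullet> z) \<longlonglongrightarrow> l z" for z
    using conv unfolding l_def by (simp add: convergent_LIMSEQ_iff)
  have bl: "bounded_linear l"
  proof (rule bounded_linear_intro)
    fix x y :: 'x and c :: real
    show "l (x + y) = l x + l y"
      using LIMSEQ_unique[OF l[of "x + y"]] tendsto_add[OF l[of x] l[of y]]
      by (simp add: inner_add_right)
    show "l (c *\<^sub>R x) = c *\<^sub>R l x"
      using LIMSEQ_unique[OF l[of "c *\<^sub>R x"]] tendsto_mult_left[OF l[of x], of c]
      by simp
    have "norm (t k \<bullet> x) \<le> norm x * K" for k
      using Cauchy_Schwarz_ineq2[of "t k" x] mult_right_mono[OF t_K[of k] norm_ge_zero[of x]]
      by (simp add: mult.commute)
    then show "norm (l x) \<le> norm x * K"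
      by (intro Lim_bounded[OF tendsto_norm[OF l[of x]]]) auto
  qed
  obtain x where x: "x \<in> Y" "\<forall>c\<in>Y. l (c - x) \<le> x \<bullet> (c - x)"
    using variational_inequality_solvable[OF Y(2) _ _ bl] Y subspace_imp_convex[of Y] subspace_0[of Y]
    by blast
  have lY: "l y = x \<bullet> y" if "y \<in> Y" for y
    using subspace_variational_equality[OF Y(1) x(1) _ x(2) that] bl
    by (simp add: bounded_linear.linear)
  have "l z = x \<bullet> z" for z
  proof -
    obtain p where p: "p \<in> Y" "\<forall>y\<in>Y. z \<bullet> y = p \<bullet> y" using split by blast
    then have "(\<lambda>k. t k \<bullet> z) = (\<lambda>k. t k \<bullet> p)" using tY by (simp add: inner_commute[of "t _"])
    then have "l z = l p" by (simp add: l_def)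
    also have "\<dots> = x \<bullet> z" using lY p x(1) by (simp add: inner_commute)
    finally show ?thesis .
  qed
  then show ?thesis using l x(1) YX subseq_diagseq unfolding t_def by auto
qed

lemma limitin_weak_topology:
  assumes "range s \<subseteq> X" "x \<in> X" "\<And>z. (\<lambda>k. s k \<bullet> z) \<longlonglongrightarrow> x \<bullet> z"
  shows "limitin (weak_topology X) s x sequentially"
proof -
  have lim: "limitin euclidean (\<lambda>k z. s k \<bullet> z) (\<lambda>z. x \<bullet> z) sequentially"
    unfolding euclidean_product_topology[symmetric] limitin_componentwise using assms(3) by simp
  show ?thesis
    unfolding limitin_def weak_topology_def topspace_pullback_topology
  proof (intro conjI allI impI)
    show "x \<in> (\<lambda>x y. x \<bullet> y) -` topspace euclidean \<inter> X" using assms(2) by simp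
    fix U assume "openin (pullback_topology X (\<lambda>x y. x \<bullet> y) euclidean) U \<and> x \<in> U"
    then obtain W where W: "openin euclidean W" "U = (\<lambda>x y. x \<bullet> y) -` W \<inter> X" "x \<in> U"
      unfolding openin_pullback_topology by blast
    then have "\<forall>\<^sub>F k in sequentially. (\<lambda>z. s k \<bullet> z) \<in> W"
      using lim unfolding limitin_def by auto
    then show "\<forall>\<^sub>F k in sequentially. s k \<in> U"
      by (rule eventually_mono) (use assms(1) in \<open>auto simp: W(2)\<close>)
  qed
qed

lemma weakly_lsc_eventually_less:
  assumes "weakly_lsc X Q" "limitin (weak_topology X) s x sequentially" "range s \<subseteq> X"
    and "\<alpha> < Q x"
  shows "\<forall>\<^sub>F k in sequentially. \<alpha> < Q (s k)"
proof -
  let ?W = "topspace (weak_topology X) - {x \<in> X. Q x \<le> \<alpha>}"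
  have "openin (weak_topology X) ?W" using assms(1) by (simp add: weakly_lsc_def openin_diff)
  moreover have "x \<in> ?W" using assms(2,4) by (simp add: limitin_topspace)
  ultimately have "\<forall>\<^sub>F k in sequentially. s k \<in> ?W"
    using assms(2) unfolding limitin_def by blast
  then show ?thesis by (rule eventually_mono) (use assms(3) in auto)
qed

text \<open>
  The constant \<open>1/2\<close> and the bound on the displacement of the centre together keep the ball invariant.
\<close>

lemma contraction_fixed_point_cball:
  fixes C :: "'x::complete_space set"
  assumes "closed C" "xb \<in> C" "0 \<le> \<eta>"
    and "\<And>x. x \<in> C \<inter> cball xb \<eta> \<Longrightarrow> \<Phi> x \<in> C"
    and contr: "\<And>x y. x \<in> C \<inter> cball xb \<eta> \<Longrightarrow> y \<in> C \<inter> cball xb \<eta> \<Longrightarrow> dist (\<Phi> x) (\<Phi> y) \<le> dist x y / 2"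
    and base: "dist (\<Phi> xb) xb \<le> \<eta> / 2"
  shows "\<exists>x\<in>C \<inter> cball xb \<eta>. \<Phi> x = x"
proof -
  have xb: "xb \<in> C \<inter> cball xb \<eta>" using assms by simp
  have "\<exists>!x. x \<in> C \<inter> cball xb \<eta> \<and> \<Phi> x = x"
  proof (rule Banach_fix[where c = "1/2"])
    show "complete (C \<inter> cball xb \<eta>)" using assms by (simp add: complete_eq_closed closed_Int)
    show "\<Phi> ` (C \<inter> cball xb \<eta>) \<subseteq> C \<inter> cball xb \<eta>"
    proof clarify
      fix x assume x: "x \<in> C" "x \<in> cball xb \<eta>"
      then have "dist (\<Phi> x) (\<Phi> xb) \<le> \<eta> / 2"
        using contr[of x xb] xb by (simp add: dist_commute)
      then have "dist xb (\<Phi> x) \<le> \<eta>"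
        using base dist_triangle[of xb "\<Phi> x" "\<Phi> xb"] by (simp add: dist_commute)
      then show "\<Phi> x \<in> C \<inter> cball xb \<eta>" using assms(4) x by simp
    qed
  qed (use xb contr in auto)
  then show ?thesis by blast
qed

section \<open>From local strong monotonicity to full stability\<close>

lemma nbhd_in_iff_ball:
  fixes x :: "'a::metric_space"
  shows "nbhd_in X x U \<longleftrightarrow> x \<in> X \<and> U \<subseteq> X \<and> (\<exists>e>0. X \<inter> ball x e \<subseteq> U)"
proof
  assume "nbhd_in X x U"
  then obtain T where T: "U \<subseteq> X" "openin (top_of_set X) T" "x \<in> T" "T \<subseteq> U"
    unfolding nbhd_in_def by blast
  then obtain e where "e > 0" "ball x e \<inter> X \<subseteq> T"
    unfolding openin_contains_ball by blast
  then show "x \<in> X \<and> U \<subseteq> X \<and> (\<exists>e>0. X \<inter> ball x e \<subseteq> U)" using T by blast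
next
  assume "x \<in> X \<and> U \<subseteq> X \<and> (\<exists>e>0. X \<inter> ball x e \<subseteq> U)"
  then obtain e where e: "x \<in> X" "U \<subseteq> X" "e > 0" "X \<inter> ball x e \<subseteq> U" by blast
  then have "openin (top_of_set X) (X \<inter> ball x e)" by (simp add: openin_open_Int)
  then show "nbhd_in X x U" unfolding nbhd_in_def using e by (intro conjI exI[of _ "X \<inter> ball x e"]) auto
qed

lemma solution_map_iff:
  assumes "C \<subseteq> X"
  shows "x \<in> solution_map X C f v p \<longleftrightarrow> v - f x p \<in> normal_cone X C x"
proof -
  have "v \<in> (\<lambda>u. f x p + u) ` normal_cone X C x \<longleftrightarrow> v - f x p \<in> normal_cone X C x"
    by (auto simp: image_iff intro: bexI[of _ "v - f x p"])
  moreover have "x \<in> X" if "v - f x p \<in> normal_cone X C x"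
    using that assms by (auto simp: normal_cone_def split: if_splits)
  ultimately show ?thesis by (auto simp: solution_map_def)
qed

lemma normal_coneD:
  assumes "u \<in> normal_cone X C x"
  shows "u \<in> X" "x \<in> C" "c \<in> C \<Longrightarrow> u \<bullet> (c - x) \<le> 0"
  using assms by (auto simp: normal_cone_def split: if_splits)

lemma normal_cone_monotone:
  assumes "u1 \<in> normal_cone X C x1" "u2 \<in> normal_cone X C x2"
  shows "0 \<le> (u1 - u2) \<bullet> (x1 - x2)"
  using normal_coneD(3)[OF assms(1) normal_coneD(2)[OF assms(2)]]
    normal_coneD(3)[OF assms(2) normal_coneD(2)[OF assms(1)]]
  by (simp add: inner_simps)

text \<open>
  Here \<open>x1\<close> and \<open>x2\<close> are the projections of \<open>a1\<close> and \<open>a2\<close>, characterised by their normals.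
\<close>

lemma proximal_nonexpansive:
  assumes "a1 - x1 \<in> normal_cone X C x1" "a2 - x2 \<in> normal_cone X C x2"
  shows "norm (x1 - x2) \<le> norm (a1 - a2)"
proof -
  have "(norm (x1 - x2))\<^sup>2 \<le> (a1 - a2) \<bullet> (x1 - x2)"
    using normal_cone_monotone[OF assms] by (simp add: power2_norm_eq_inner inner_simps)
  also have "\<dots> \<le> norm (a1 - a2) * norm (x1 - x2)" by (rule norm_cauchy_schwarz)
  finally show ?thesis
    by (metis mult_le_cancel_right_pos norm_ge_zero order_le_less power2_eq_square)
qed

lemma norm_diff_scaleR_power2:
  fixes v x :: "'x::real_inner"
  shows "(norm (v - c *\<^sub>R x))\<^sup>2 = (norm v)\<^sup>2 - 2 * c * (v \<bullet> x) + c\<^sup>2 * (norm x)\<^sup>2"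
  unfolding power2_norm_eq_inner power2_eq_square[of c]
  by (simp add: inner_diff_left inner_diff_right inner_commute[of x v] algebra_simps)

lemma normal_cone_scaleR:
  assumes "u \<in> normal_cone X C x" "subspace X" "0 \<le> c"
  shows "c *\<^sub>R u \<in> normal_cone X C x"
  using assms by (auto simp: normal_cone_def subspace_scale mult_le_0_iff split: if_splits)

text \<open>
  The localisation is to the graph of the normal cone mapping around \<open>(xb, ub)\<close>: closeness is required
  of the points as well as of the normals. Strong monotonicity of \<open>f(\<cdot>, p)\<close> itself would be too much
  to ask, since \<open>f\<close> may fail to be monotone in directions that are blocked by active constraints.
\<close>

definition locally_strongly_monotone ::
  "'x::real_inner set \<Rightarrow> 'x set \<Rightarrow> ('x \<Rightarrow> 'p::metric_space \<Rightarrow> 'x) \<Rightarrow> 'x \<Rightarrow> 'x \<Rightarrow> 'p \<Rightarrow> bool" where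
  "locally_strongly_monotone X C f ub xb pb \<longleftrightarrow>
     (\<exists>\<kappa>>0. \<exists>r>0. \<forall>p x1 x2. \<forall>u1\<in>normal_cone X C x1. \<forall>u2\<in>normal_cone X C x2.
        dist p pb < r \<and> dist x1 xb < r \<and> dist x2 xb < r \<and> dist u1 ub < r \<and> dist u2 ub < r \<longrightarrow>
          \<kappa> * (norm (x1 - x2))\<^sup>2 \<le> (f x1 p - f x2 p + (u1 - u2)) \<bullet> (x1 - x2))"

text \<open>
  Existence of solutions is by continuation in \<open>t\<close> for the inclusion \<open>v \<in> f x p + t (x - xb) + N x\<close>,
  of which \<open>xb\<close> is a solution for \<open>(vb, pb)\<close> whatever \<open>t\<close> is. As long as \<open>t \<ge> 0\<close>, the additional term
  only helps monotonicity, so all these inclusions share the modulus \<open>\<kappa>\<close> and the radius \<open>r0\<close>, and their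
  solutions are \<open>1/\<kappa>\<close>-Lipschitz in \<open>v\<close>. Rewriting the inclusion for \<open>t - \<tau>\<close> as the one for \<open>t\<close> with
  \<open>v\<close> replaced by \<open>v + \<tau> (x - xb)\<close> therefore gives a contraction for \<open>\<tau> = \<kappa>/2\<close>. The step length is
  independent of \<open>t\<close>, so the neighbourhoods of \<open>(vb, pb)\<close>, which shrink at each step, shrink only
  finitely often.
\<close>

lemma fully_stable_if_locally_strongly_monotone:
  fixes X C :: "'x::{real_inner,complete_space} set"
    and f :: "'x \<Rightarrow> 'p::metric_space \<Rightarrow> 'x"
  assumes X: "subspace X" and C: "C \<subseteq> X" "closed C" "convex C"
    and f: "\<forall>x\<in>X. \<forall>p. f x p \<in> X"
    and sol: "xb \<in> solution_map X C f vb pb"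
    and lip: "locally_lipschitz_at X f xb pb"
    and mono: "locally_strongly_monotone X C f (vb - f xb pb) xb pb"
  shows "fully_stable X (solution_map X C f) vb pb xb"
proof -
  define ub where "ub = vb - f xb pb"
  have ub: "ub \<in> normal_cone X C xb" using sol C by (simp add: solution_map_iff ub_def)
  then have xb: "xb \<in> C" "xb \<in> X" and "ub \<in> X" using C by (auto dest: normal_coneD)
  have vb: "vb \<in> X"
    using subspace_add[OF X \<open>ub \<in> X\<close>, of "f xb pb"] f xb by (simp add: ub_def)
  obtain L r1 where L: "L > 0" "r1 > 0" and lip1:
    "\<And>x1 x2 p1 p2. \<lbrakk>x1 \<in> X; x2 \<in> X; dist x1 xb < r1; dist x2 xb < r1; dist p1 pb < r1; dist p2 pb < r1\<rbrakk>
      \<Longrightarrow> norm (f x1 p1 - f x2 p2) \<le> L * (norm (x1 - x2) + dist p1 p2)"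
  proof -
    obtain L U P where U: "L > 0" "nbhd_in X xb U" "nbhd_in UNIV pb P"
      "\<forall>x1\<in>U. \<forall>x2\<in>U. \<forall>p1\<in>P. \<forall>p2\<in>P. norm (f x1 p1 - f x2 p2) \<le> L * (norm (x1 - x2) + dist p1 p2)"
      using lip unfolding locally_lipschitz_at_def by blast
    then obtain e e' where "e > 0" "X \<inter> ball xb e \<subseteq> U" "e' > 0" "ball pb e' \<subseteq> P"
      by (auto simp: nbhd_in_iff_ball)
    with U show thesis
      by (intro that[of L "min e e'"]) (auto simp: subset_iff dist_commute)
  qed
  obtain \<kappa> r2 where \<kappa>: "\<kappa> > 0" "r2 > 0" and mono2:
    "\<And>p x1 x2 u1 u2. \<lbrakk>u1 \<in> normal_cone X C x1; u2 \<in> normal_cone X C x2; dist p pb < r2;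
       dist x1 xb < r2; dist x2 xb < r2; dist u1 ub < r2; dist u2 ub < r2\<rbrakk>
       \<Longrightarrow> \<kappa> * (norm (x1 - x2))\<^sup>2 \<le> (f x1 p - f x2 p + (u1 - u2)) \<bullet> (x1 - x2)"
    using mono unfolding locally_strongly_monotone_def ub_def by blast
  \<comment> \<open>\<open>T\<close> is a multiple of the step length \<open>\<tau>\<close> that is large enough for the projection argument.\<close>
  define \<tau> where "\<tau> = \<kappa> / 2"
  have \<tau>: "\<tau> > 0" using \<kappa> by (simp add: \<tau>_def)
  obtain N :: nat where N: "2 * L / \<tau> < real N" using reals_Archimedean2 by blast
  define T where "T = N * \<tau>"
  have T: "2 * L \<le> T" using N \<tau> by (simp add: T_def field_simps)
  then have T0: "T > 0" using L by simp
  \<comment> \<open>\<open>r0\<close> is so small that, for every \<open>t \<le> T\<close>, a solution within \<open>r0\<close> has its normal within \<open>r2\<close> of \<open>ub\<close>.\<close>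
  define r0 where "r0 = min r1 r2 / (2 * (1 + 2 * L + T))"
  have "r0 * (2 * (1 + 2 * L + T)) = min r1 r2" using L T0 by (simp add: r0_def)
  then have r0_eq: "2 * r0 + 4 * (L * r0) + 2 * (T * r0) = min r1 r2" by (simp add: algebra_simps)
  have r0: "r0 > 0" using L \<kappa> T0 by (simp add: r0_def)
  then have "L * r0 > 0" "T * r0 > 0" using L T0 by auto
  with r0_eq r0 have r0_less: "r0 < r1" "r0 < r2" "r0 + 2 * (L * r0) + T * r0 < r2" by linarith+
  define Sol where "Sol t v p x \<longleftrightarrow> dist x xb \<le> r0 \<and> v - f x p - t *\<^sub>R (x - xb) \<in> normal_cone X C x"
    for t v p x
  have Sol_C: "x \<in> C" "x \<in> X" if "Sol t v p x" for t v p x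
    using that C by (auto simp: Sol_def dest: normal_coneD)
  have Sol_b: "Sol t vb pb xb" for t using ub r0 by (simp add: Sol_def ub_def)
  have Sol_u: "dist (v - f x p - t *\<^sub>R (x - xb)) ub < r2"
    if "Sol t v p x" "0 \<le> t" "t \<le> T" "dist v vb \<le> r0" "dist p pb \<le> r0" for t v p x
  proof -
    have xr: "norm (x - xb) \<le> r0" using that by (simp add: Sol_def dist_norm)
    have "norm (f x p - f xb pb) \<le> L * (norm (x - xb) + dist p pb)"
      using that Sol_C[OF that(1)] xb r0_less r0 L xr
      by (intro lip1) (auto simp: dist_norm)
    also have "\<dots> \<le> L * (r0 + r0)" using xr that L by (intro mult_left_mono) auto
    finally have 1: "norm (f x p - f xb pb) \<le> 2 * (L * r0)" by simp
    have 2: "norm (t *\<^sub>R (x - xb)) \<le> T * r0"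
      using mult_mono[of t T "norm (x - xb)" r0] that xr T0 by simp
    have eq: "v - f x p - t *\<^sub>R (x - xb) - ub = (v - vb) - (f x p - f xb pb) - t *\<^sub>R (x - xb)"
      by (simp add: ub_def algebra_simps)
    have "norm (v - f x p - t *\<^sub>R (x - xb) - ub)
        \<le> norm (v - vb) + norm (f x p - f xb pb) + norm (t *\<^sub>R (x - xb))"
      unfolding eq using norm_triangle_ineq4[of "(v - vb) - (f x p - f xb pb)" "t *\<^sub>R (x - xb)"]
        norm_triangle_ineq4[of "v - vb" "f x p - f xb pb"] by linarith
    then show ?thesis using 1 2 that r0_less by (simp add: dist_norm)
  qed
  have estimate: "\<kappa> * (norm (x1 - x2))\<^sup>2 \<le> (v1 - v2) \<bullet> (x1 - x2) + L * dist p1 p2 * norm (x1 - x2)"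
    if S: "Sol t v1 p1 x1" "Sol t v2 p2 x2" and t: "0 \<le> t" "t \<le> T"
      and "dist v1 vb \<le> r0" "dist v2 vb \<le> r0" "dist p1 pb \<le> r0" "dist p2 pb \<le> r0"
    for t v1 v2 p1 p2 x1 x2
  proof -
    define u1 where "u1 = v1 - f x1 p1 - t *\<^sub>R (x1 - xb)"
    define u2 where "u2 = v2 - f x2 p2 - t *\<^sub>R (x2 - xb)"
    have u: "u1 \<in> normal_cone X C x1" "u2 \<in> normal_cone X C x2"
      using S by (auto simp: Sol_def u1_def u2_def)
    have x: "dist x1 xb \<le> r0" "dist x2 xb \<le> r0" using S by (auto simp: Sol_def)
    have "\<kappa> * (norm (x1 - x2))\<^sup>2 \<le> (f x1 p1 - f x2 p1 + (u1 - u2)) \<bullet> (x1 - x2)"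
      using that x r0_less Sol_u[OF S(1)] Sol_u[OF S(2)] u
      by (intro mono2) (auto simp: u1_def u2_def)
    also have "f x1 p1 - f x2 p1 + (u1 - u2) = (v1 - v2) + (f x2 p2 - f x2 p1) - t *\<^sub>R (x1 - x2)"
      by (simp add: u1_def u2_def algebra_simps)
    also have "\<dots> \<bullet> (x1 - x2) = (v1 - v2) \<bullet> (x1 - x2) + (f x2 p2 - f x2 p1) \<bullet> (x1 - x2)
        - t * (norm (x1 - x2))\<^sup>2"
      by (simp add: inner_add_left inner_diff_left[of _ "t *\<^sub>R (x1 - x2)"] power2_norm_eq_inner)
    also have "\<dots> \<le> (v1 - v2) \<bullet> (x1 - x2) + (f x2 p2 - f x2 p1) \<bullet> (x1 - x2)"
      using t by simp
    also have "(f x2 p2 - f x2 p1) \<bullet> (x1 - x2) \<le> L * dist p1 p2 * norm (x1 - x2)"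
    proof -
      have "norm (f x2 p2 - f x2 p1) \<le> L * (norm (x2 - x2) + dist p2 p1)"
        using that x r0_less Sol_C[OF S(2)] by (intro lip1) auto
      then have "norm (f x2 p2 - f x2 p1) \<le> L * dist p1 p2" by (simp add: dist_commute)
      from order_trans[OF norm_cauchy_schwarz mult_right_mono[OF this norm_ge_zero]] show ?thesis .
    qed
    finally show ?thesis by simp
  qed
  have estimate_norm: "\<kappa> * norm (x1 - x2) \<le> norm (v1 - v2) + L * dist p1 p2"
    if "\<kappa> * (norm (x1 - x2))\<^sup>2 \<le> (v1 - v2) \<bullet> (x1 - x2) + L * dist p1 p2 * norm (x1 - x2)"
    for v1 v2 x1 x2 :: 'x and p1 p2 :: 'p
  proof (cases "x1 = x2")
    case True
    then show ?thesis using L by simp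
  next
    case False
    have "(\<kappa> * norm (x1 - x2)) * norm (x1 - x2) \<le> (norm (v1 - v2) + L * dist p1 p2) * norm (x1 - x2)"
      using that norm_cauchy_schwarz[of "v1 - v2" "x1 - x2"]
      by (simp add: power2_eq_square algebra_simps)
    then show ?thesis using False by simp
  qed
  \<comment> \<open>\<open>E t\<close> is what is propagated from \<open>t = T\<close> down to \<open>t = 0\<close>; the radius \<open>\<rho>\<close> may depend on \<open>t\<close>.\<close>
  define E where "E t \<longleftrightarrow> (\<exists>\<rho>>0. \<rho> \<le> r0 \<and>
      (\<forall>v p. v \<in> X \<and> dist v vb < \<rho> \<and> dist p pb < \<rho> \<longrightarrow> (\<exists>x. Sol t v p x)))" for t
  have start: "E T"
  proof -
    have "\<exists>\<pi>. \<forall>a. \<pi> a \<in> C \<and> (\<forall>c\<in>C. (a - \<pi> a) \<bullet> (c - \<pi> a) \<le> 0)"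
      using projection_exists[OF C(2,3)] xb by (intro choice) blast
    then obtain \<pi> where \<pi>: "\<And>a. \<pi> a \<in> C" "\<And>a c. c \<in> C \<Longrightarrow> (a - \<pi> a) \<bullet> (c - \<pi> a) \<le> 0"
      by blast
    have \<pi>N: "a - \<pi> a \<in> normal_cone X C (\<pi> a)" if "a \<in> X" for a
      using \<pi> subspace_diff[OF X that subsetD[OF C(1) \<pi>(1)]] by (auto simp: normal_cone_def)
    define \<rho> where "\<rho> = min r0 (T * r0 / (2 * (1 + L)))"
    have \<rho>: "\<rho> > 0" "\<rho> \<le> r0" "(1 + L) * \<rho> \<le> T * r0 / 2"
    proof -
      show "\<rho> > 0" "\<rho> \<le> r0" using r0 T0 L by (auto simp: \<rho>_def)
      have "\<rho> \<le> T * r0 / (2 * (1 + L))" by (simp add: \<rho>_def)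
      then show "(1 + L) * \<rho> \<le> T * r0 / 2" using L by (simp add: field_simps)
    qed
    have "\<exists>x. Sol T v p x" if v: "v \<in> X" "dist v vb < \<rho>" "dist p pb < \<rho>" for v p
    proof -
      \<comment> \<open>\<open>x\<close> solves the inclusion for \<open>T\<close> exactly if it is the projection of \<open>a x\<close>.\<close>
      define a where "a x = xb + (1 / T) *\<^sub>R (v - f x p)" for x
      have a: "a x \<in> X" if "x \<in> X" for x
        unfolding a_def using X xb v f that by (intro subspace_add subspace_scale subspace_diff) auto
      have a_diff: "norm (a x - y) = norm (v - f x p - w) / T" if "y = xb + (1 / T) *\<^sub>R w" for x y w
      proof -
        have "a x - y = (1 / T) *\<^sub>R (v - f x p - w)"
          unfolding a_def that by (simp add: algebra_simps)
        then show ?thesis using T0 by simp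
      qed
      have xbN: "(xb + (1 / T) *\<^sub>R ub) - xb \<in> normal_cone X C xb"
        using normal_cone_scaleR[OF ub X, of "1 / T"] T0 by simp
      have "\<exists>x\<in>C \<inter> cball xb r0. \<pi> (a x) = x"
      proof (rule contraction_fixed_point_cball)
        fix x y assume x: "x \<in> C \<inter> cball xb r0" and y: "y \<in> C \<inter> cball xb r0"
        then have X': "x \<in> X" "y \<in> X" using C by auto
        have "norm (\<pi> (a x) - \<pi> (a y)) \<le> norm (a x - a y)"
          using X' by (intro proximal_nonexpansive[OF \<pi>N \<pi>N] a)
        also have "\<dots> = norm (f y p - f x p) / T"
          by (subst a_diff[OF a_def]) (simp add: algebra_simps)
        also have "\<dots> \<le> (L * (norm (y - x) + dist p p)) / T"
          using x y X' T0 v \<rho> r0_less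
          by (intro divide_right_mono lip1) (auto simp: dist_commute)
        also have "\<dots> \<le> norm (x - y) / 2"
          using T T0 mult_right_mono[OF T norm_ge_zero[of "x - y"]]
          by (simp add: field_simps norm_minus_commute)
        finally show "dist (\<pi> (a x)) (\<pi> (a y)) \<le> dist x y / 2" by (simp add: dist_norm)
      next
        have "norm (\<pi> (a xb) - xb) \<le> norm (a xb - (xb + (1 / T) *\<^sub>R ub))"
          using xb by (intro proximal_nonexpansive[OF \<pi>N[OF a] xbN])
        also have "\<dots> = norm ((v - vb) - (f xb p - f xb pb)) / T"
          by (subst a_diff[OF refl]) (simp add: ub_def algebra_simps)
        also have "\<dots> \<le> (norm (v - vb) + norm (f xb p - f xb pb)) / T"
          using T0 by (intro divide_right_mono norm_triangle_ineq4) auto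
        also have "norm (f xb p - f xb pb) \<le> L * (norm (xb - xb) + dist p pb)"
          using xb v \<rho> r0_less r0 L by (intro lip1) auto
        also have "norm (v - vb) + L * (norm (xb - xb) + dist p pb) \<le> \<rho> + L * \<rho>"
          using v L by (intro add_mono) (auto simp: dist_norm)
        also have "\<dots> \<le> T * r0 / 2" using \<rho> by (simp add: algebra_simps)
        finally show "dist (\<pi> (a xb)) xb \<le> r0 / 2" using T0 by (simp add: dist_norm divide_right_mono)
      qed (use C xb r0 \<pi> in auto)
      then obtain x where x: "x \<in> C" "dist x xb \<le> r0" "\<pi> (a x) = x"
        by (auto simp: dist_commute)
      then have "a x - x \<in> normal_cone X C x" using \<pi>N[OF a, of x] C by auto
      then have "T *\<^sub>R (a x - x) \<in> normal_cone X C x"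
        using normal_cone_scaleR[OF _ X] T0 by (simp add: less_imp_le)
      also have "T *\<^sub>R (a x - x) = v - f x p - T *\<^sub>R (x - xb)"
        using T0 by (simp add: a_def algebra_simps)
      finally show ?thesis using x by (auto simp: Sol_def)
    qed
    then show ?thesis using \<rho> unfolding E_def by blast
  qed
  have step: "E (t - \<tau>)" if t: "\<tau> \<le> t" "t \<le> T" and "E t" for t
  proof -
    obtain \<rho> where \<rho>: "\<rho> > 0" "\<rho> \<le> r0"
      and "\<And>v p. v \<in> X \<Longrightarrow> dist v vb < \<rho> \<Longrightarrow> dist p pb < \<rho> \<Longrightarrow> \<exists>x. Sol t v p x"
      using \<open>E t\<close> unfolding E_def by blast
    then obtain \<sigma> where \<sigma>: "\<And>v p. v \<in> X \<Longrightarrow> dist v vb < \<rho> \<Longrightarrow> dist p pb < \<rho> \<Longrightarrow> Sol t v p (\<sigma> v p)"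
      by metis
    \<comment> \<open>Moving \<open>x\<close> by at most \<open>\<eta>\<close> shifts the right-hand side by at most \<open>\<rho> / 2\<close>, so \<open>\<sigma>\<close> stays applicable.\<close>
    define \<eta> where "\<eta> = min r0 (\<rho> / (2 * \<tau>))"
    have \<eta>: "\<eta> > 0" "\<eta> \<le> r0" "\<tau> * \<eta> \<le> \<rho> / 2"
    proof -
      show "\<eta> > 0" "\<eta> \<le> r0" using r0 \<rho> \<tau> by (auto simp: \<eta>_def)
      have "\<eta> \<le> \<rho> / (2 * \<tau>)" by (simp add: \<eta>_def)
      then show "\<tau> * \<eta> \<le> \<rho> / 2" using \<tau> by (simp add: field_simps)
    qed
    define \<rho>' where "\<rho>' = min (\<rho> / 2) (\<tau> * \<eta> / (1 + L))"
    have \<rho>': "\<rho>' > 0" "\<rho>' \<le> \<rho> / 2" "(1 + L) * \<rho>' \<le> \<tau> * \<eta>"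
    proof -
      show "\<rho>' > 0" using L \<rho> \<tau> \<eta> by (auto simp: \<rho>'_def)
      show "\<rho>' \<le> \<rho> / 2" unfolding \<rho>'_def by (rule min.cobounded1)
      have "\<rho>' \<le> \<tau> * \<eta> / (1 + L)" by (simp add: \<rho>'_def)
      then show "(1 + L) * \<rho>' \<le> \<tau> * \<eta>" using L by (simp add: field_simps)
    qed
    have "\<exists>x. Sol (t - \<tau>) v p x" if v: "v \<in> X" "dist v vb < \<rho>'" "dist p pb < \<rho>'" for v p
    proof -
      define w where "w x = v + \<tau> *\<^sub>R (x - xb)" for x
      have w: "w x \<in> X" "dist (w x) vb < \<rho>" if "x \<in> X" "x \<in> cball xb \<eta>" for x
      proof -
        show "w x \<in> X"
          unfolding w_def using X xb v that by (intro subspace_add subspace_scale subspace_diff)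
        have "norm (w x - vb) \<le> norm (v - vb) + norm (\<tau> *\<^sub>R (x - xb))"
          using norm_triangle_ineq[of "v - vb" "\<tau> *\<^sub>R (x - xb)"] by (simp add: w_def algebra_simps)
        also have "norm (\<tau> *\<^sub>R (x - xb)) \<le> \<tau> * \<eta>"
          using that \<tau> by (simp add: dist_norm norm_minus_commute)
        finally show "dist (w x) vb < \<rho>" using v \<eta> \<rho>' by (simp add: dist_norm)
      qed
      have p: "dist p pb < \<rho>" using v \<rho>' \<rho> by simp
      have S: "Sol t (w x) p (\<sigma> (w x) p)" if "x \<in> C \<inter> cball xb \<eta>" for x
        using w[of x] p that C by (intro \<sigma>) auto
      have "\<exists>x\<in>C \<inter> cball xb \<eta>. \<sigma> (w x) p = x"
      proof (rule contraction_fixed_point_cball)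
        show "\<sigma> (w x) p \<in> C" if "x \<in> C \<inter> cball xb \<eta>" for x
          using Sol_C[OF S[OF that]] by blast
      next
        fix x y assume x: "x \<in> C \<inter> cball xb \<eta>" and y: "y \<in> C \<inter> cball xb \<eta>"
        have "\<kappa> * norm (\<sigma> (w x) p - \<sigma> (w y) p) \<le> norm (w x - w y) + L * dist p p"
          using x y t \<tau> w[of x] w[of y] p \<rho> C
          by (intro estimate_norm estimate[OF S[OF x] S[OF y]]) auto
        also have "w x - w y = \<tau> *\<^sub>R (x - y)" by (simp add: w_def algebra_simps)
        also have "norm (\<tau> *\<^sub>R (x - y)) + L * dist p p = \<kappa> * (norm (x - y) / 2)"
          using \<tau> by (simp add: \<tau>_def)
        finally show "dist (\<sigma> (w x) p) (\<sigma> (w y) p) \<le> dist x y / 2"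
          using \<kappa> by (simp add: dist_norm)
      next
        have xb': "xb \<in> C \<inter> cball xb \<eta>" using xb \<eta> by simp
        have "\<kappa> * norm (\<sigma> (w xb) p - xb) \<le> norm (w xb - vb) + L * dist p pb"
          using t \<tau> w[of xb] p \<rho> xb xb' r0
          by (intro estimate_norm estimate[OF S[OF xb'] Sol_b]) auto
        also have "\<dots> \<le> \<rho>' + L * \<rho>'"
          using v L by (intro add_mono) (auto simp: dist_norm w_def)
        also have "\<dots> \<le> \<kappa> * (\<eta> / 2)" using \<rho>' by (simp add: algebra_simps \<tau>_def)
        finally show "dist (\<sigma> (w xb) p) xb \<le> \<eta> / 2" using \<kappa> by (simp add: dist_norm)
      qed (use C xb \<eta> in auto)
      then obtain x where x: "x \<in> C \<inter> cball xb \<eta>" "\<sigma> (w x) p = x" by blast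
      with S[OF x(1)] have "Sol t (w x) p x" by simp
      moreover have "w x - f x p - t *\<^sub>R (x - xb) = v - f x p - (t - \<tau>) *\<^sub>R (x - xb)"
        by (simp add: w_def algebra_simps)
      ultimately show ?thesis by (auto simp: Sol_def)
    qed
    then show ?thesis using \<rho> \<rho>' unfolding E_def by (intro exI[of _ \<rho>']) auto
  qed
  have "E (T - n * \<tau>)" if "n \<le> N" for n :: nat
    using that
  proof (induction n)
    case 0
    then show ?case using start by simp
  next
    case (Suc n)
    have "real (Suc n) * \<tau> \<le> T" unfolding T_def using Suc.prems \<tau> by (intro mult_right_mono) auto
    then have "E (T - n * \<tau> - \<tau>)"
      using Suc \<tau> by (intro step) (auto simp: algebra_simps)
    then show ?case by (simp add: algebra_simps)
  qed
  from this[of N] have "E 0" by (simp add: T_def)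
  then obtain \<rho> where \<rho>: "\<rho> > 0" "\<rho> \<le> r0"
    and "\<And>v p. v \<in> X \<Longrightarrow> dist v vb < \<rho> \<Longrightarrow> dist p pb < \<rho> \<Longrightarrow> \<exists>x. Sol 0 v p x"
    unfolding E_def by blast
  then obtain \<theta> where \<theta>: "\<And>v p. v \<in> X \<Longrightarrow> dist v vb < \<rho> \<Longrightarrow> dist p pb < \<rho> \<Longrightarrow> Sol 0 v p (\<theta> v p)"
    by metis
  define V where "V = X \<inter> ball vb \<rho>"
  define P where "P = ball pb \<rho>"
  define U where "U = X \<inter> cball xb r0"
  have V: "v \<in> X" "dist v vb < \<rho>" "dist v vb \<le> r0" if "v \<in> V" for v
    using that \<rho> by (auto simp: V_def dist_commute)
  have P: "dist p pb < \<rho>" "dist p pb \<le> r0" if "p \<in> P" for p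
    using that \<rho> by (auto simp: P_def dist_commute)
  have Sol_iff: "Sol 0 v p x \<longleftrightarrow> x \<in> solution_map X C f v p \<and> x \<in> U" for v p x
    using C by (auto simp: Sol_def solution_map_iff U_def dist_commute dest: normal_coneD)
  have est0: "\<kappa> * (norm (x1 - x2))\<^sup>2 \<le> (v1 - v2) \<bullet> (x1 - x2) + L * dist p1 p2 * norm (x1 - x2)"
    if "Sol 0 v1 p1 x1" "Sol 0 v2 p2 x2" "v1 \<in> V" "v2 \<in> V" "p1 \<in> P" "p2 \<in> P" for v1 v2 p1 p2 x1 x2
    using that T0 V P by (intro estimate) auto
  have unique: "x = \<theta> v p" if "Sol 0 v p x" "v \<in> V" "p \<in> P" for v p x
    using estimate_norm[OF est0[OF that(1) \<theta> that(2,2,3,3)]] V[OF that(2)] P[OF that(3)] \<kappa>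
    by (simp add: mult_le_0_iff)
  have "norm ((v1 - v2) - (2 * \<kappa>) *\<^sub>R (\<theta> v1 p1 - \<theta> v2 p2)) \<le> norm (v1 - v2) + (2 * L) * dist p1 p2"
    if "v1 \<in> V" "v2 \<in> V" "p1 \<in> P" "p2 \<in> P" for v1 v2 p1 p2
  proof (rule power2_le_imp_le)
    \<comment> \<open>After expansion, the bounds \<open>est\<close> and \<open>nx\<close> complete the square \<open>(norm v + 2 L d)\<^sup>2\<close>.\<close>
    define x where "x = \<theta> v1 p1 - \<theta> v2 p2"
    define v where "v = v1 - v2"
    define d where "d = dist p1 p2"
    have est: "\<kappa> * (norm x)\<^sup>2 \<le> v \<bullet> x + L * d * norm x"
      unfolding x_def v_def d_def using that V P by (intro est0 \<theta>) auto
    have nx: "\<kappa> * norm x \<le> norm v + L * d"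
      using est unfolding x_def v_def d_def by (rule estimate_norm)
    have "(norm (v - (2 * \<kappa>) *\<^sub>R x))\<^sup>2 = (norm v)\<^sup>2 - 4 * \<kappa> * (v \<bullet> x) + 4 * \<kappa> * (\<kappa> * (norm x)\<^sup>2)"
      unfolding norm_diff_scaleR_power2 by (simp add: power2_eq_square)
    also have "\<dots> \<le> (norm v)\<^sup>2 - 4 * \<kappa> * (v \<bullet> x) + 4 * \<kappa> * (v \<bullet> x + L * d * norm x)"
      using est \<kappa> by (intro add_left_mono mult_left_mono) auto
    also have "\<dots> = (norm v)\<^sup>2 + 4 * (L * d) * (\<kappa> * norm x)" by (simp add: algebra_simps)
    also have "\<dots> \<le> (norm v)\<^sup>2 + 4 * (L * d) * (norm v + L * d)"
      using nx L by (intro add_left_mono mult_left_mono) (auto simp: d_def)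
    also have "\<dots> = (norm v + 2 * L * d)\<^sup>2" by (simp add: power2_eq_square algebra_simps)
    finally show "(norm ((v1 - v2) - (2 * \<kappa>) *\<^sub>R (\<theta> v1 p1 - \<theta> v2 p2)))\<^sup>2
        \<le> (norm (v1 - v2) + (2 * L) * dist p1 p2)\<^sup>2"
      by (simp add: x_def v_def d_def)
  qed (use L in simp)
  moreover have "nbhd_in X vb V" "nbhd_in UNIV pb P" "nbhd_in X xb U"
  proof -
    show "nbhd_in X vb V" unfolding nbhd_in_iff_ball V_def using vb \<rho> by auto
    show "nbhd_in UNIV pb P" unfolding nbhd_in_iff_ball P_def using \<rho> by auto
    show "nbhd_in X xb U" unfolding nbhd_in_iff_ball U_def
      using xb r0 by (intro conjI exI[of _ r0]) auto
  qed
  moreover have "\<theta> v p \<in> U" if "v \<in> V" "p \<in> P" for v p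
    using \<theta>[of v p] V[OF that(1)] P[OF that(2)] Sol_iff by blast
  moreover have "{(v, p, x). v \<in> V \<and> p \<in> P \<and> x = \<theta> v p}
      = {(v, p, x). x \<in> solution_map X C f v p} \<inter> V \<times> P \<times> U"
    using \<theta> V P Sol_iff unique by auto
  ultimately show ?thesis
    unfolding fully_stable_def
    using \<kappa>(1) L(1)
    by (intro exI[of _ V] exI[of _ P] exI[of _ U] conjI exI[of _ \<theta>] exI[of _ \<kappa>] exI[of _ "2 * L"]) auto
qed

text \<open>
  For equal parameters the stability estimate reads \<open>norm (v - 2 \<kappa> x) \<le> norm v\<close> in terms of differences;
  squaring it leaves precisely strong monotonicity.
\<close>

lemma fully_stable_imp_solution_monotone:
  assumes "fully_stable X S vb pb xb"
  shows "\<exists>\<kappa>>0. \<exists>r>0. \<forall>v1\<in>X. \<forall>v2\<in>X. \<forall>x1\<in>X \<inter> S v1 pb. \<forall>x2\<in>X \<inter> S v2 pb.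
     dist v1 vb < r \<and> dist v2 vb < r \<and> dist x1 xb < r \<and> dist x2 xb < r \<longrightarrow>
       \<kappa> * (norm (x1 - x2))\<^sup>2 \<le> (v1 - v2) \<bullet> (x1 - x2)"
proof -
  obtain V P U \<theta> \<kappa> l where n: "nbhd_in X vb V" "nbhd_in UNIV pb P" "nbhd_in X xb U"
    and gr: "{(v, p, x). v \<in> V \<and> p \<in> P \<and> x = \<theta> v p} = {(v, p, x). x \<in> S v p} \<inter> V \<times> P \<times> U"
    and "\<kappa> > 0" "l > 0" and est: "\<forall>v1\<in>V. \<forall>v2\<in>V. \<forall>p1\<in>P. \<forall>p2\<in>P.
      norm ((v1 - v2) - (2 * \<kappa>) *\<^sub>R (\<theta> v1 p1 - \<theta> v2 p2)) \<le> norm (v1 - v2) + l * dist p1 p2"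
    using assms unfolding fully_stable_def by blast
  obtain e e' where e: "e > 0" "e' > 0" "X \<inter> ball vb e \<subseteq> V" "X \<inter> ball xb e' \<subseteq> U" and "pb \<in> P"
    using n unfolding nbhd_in_iff_ball by (meson UNIV_I IntI centre_in_ball subsetD)
  have "\<kappa> * (norm (x1 - x2))\<^sup>2 \<le> (v1 - v2) \<bullet> (x1 - x2)"
    if v: "v1 \<in> X" "v2 \<in> X" "dist v1 vb < min e e'" "dist v2 vb < min e e'"
      and x: "x1 \<in> X \<inter> S v1 pb" "x2 \<in> X \<inter> S v2 pb" "dist x1 xb < min e e'" "dist x2 xb < min e e'"
    for v1 v2 x1 x2
  proof -
    have V: "v1 \<in> V" "v2 \<in> V" using v e by (auto simp: subset_iff dist_commute)
    have U: "x1 \<in> U" "x2 \<in> U" using x e by (auto simp: subset_iff dist_commute)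
    have "(v1, pb, x1) \<in> {(v, p, x). v \<in> V \<and> p \<in> P \<and> x = \<theta> v p}"
      "(v2, pb, x2) \<in> {(v, p, x). v \<in> V \<and> p \<in> P \<and> x = \<theta> v p}"
      unfolding gr using U V x \<open>pb \<in> P\<close> by auto
    then have \<theta>: "x1 = \<theta> v1 pb" "x2 = \<theta> v2 pb" by auto
    have "norm ((v1 - v2) - (2 * \<kappa>) *\<^sub>R (x1 - x2)) \<le> norm (v1 - v2)"
      using est V \<open>pb \<in> P\<close> unfolding \<theta> by fastforce
    then have "(norm ((v1 - v2) - (2 * \<kappa>) *\<^sub>R (x1 - x2)))\<^sup>2 \<le> (norm (v1 - v2))\<^sup>2"
      by (intro power_mono) auto
    also have "(norm ((v1 - v2) - (2 * \<kappa>) *\<^sub>R (x1 - x2)))\<^sup>2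
        = (norm (v1 - v2))\<^sup>2 + 4 * \<kappa> * (\<kappa> * (norm (x1 - x2))\<^sup>2 - (v1 - v2) \<bullet> (x1 - x2))"
      unfolding norm_diff_scaleR_power2 by (simp add: power2_eq_square algebra_simps)
    finally show ?thesis using \<open>\<kappa> > 0\<close> by (simp add: mult_le_0_iff)
  qed
  then show ?thesis using \<open>\<kappa> > 0\<close> e by (intro exI[of _ \<kappa>] exI[of _ "min e e'"] conjI) auto
qed

section \<open>Strict differentiability\<close>

lemma uniformly_frechet_bounded_linear:
  assumes "uniformly_frechet_at X f D xb pb"
  shows "bounded_linear (D xb pb)"
proof -
  obtain U P where "nbhd_in X xb U" "nbhd_in UNIV pb P"
    and der: "\<forall>x\<in>U. \<forall>p\<in>P. ((\<lambda>z. f z p) has_derivative D x p) (at x within X)"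
    using assms unfolding uniformly_frechet_at_def by blast
  then have "xb \<in> U" "pb \<in> P" by (auto simp: nbhd_in_def)
  then show ?thesis using der has_derivative_bounded_linear by blast
qed

text \<open>
  The mean value inequality is applied on the segment from \<open>x2\<close> to \<open>x1\<close>, parametrised by the unit
  interval, because the derivatives are controlled on \<open>X\<close> only and their operator norms as maps on the whole
  type say nothing.
\<close>

lemma uniformly_frechet_strict:
  assumes X: "subspace X" and fr: "uniformly_frechet_at X f D xb pb" and "0 < \<epsilon>"
  shows "\<exists>r>0. \<forall>x1\<in>X. \<forall>x2\<in>X. \<forall>p. dist x1 xb < r \<and> dist x2 xb < r \<and> dist p pb < r \<longrightarrow>
    norm (f x1 p - f x2 p - D xb pb (x1 - x2)) \<le> \<epsilon> * norm (x1 - x2)"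
proof -
  obtain U P where n: "nbhd_in X xb U" "nbhd_in UNIV pb P"
    and der: "\<forall>x\<in>U. \<forall>p\<in>P. ((\<lambda>z. f z p) has_derivative D x p) (at x within X)"
    and cont: "\<forall>\<epsilon>>0. \<exists>\<delta>>0. \<forall>x\<in>X. \<forall>p. norm (x - xb) < \<delta> \<and> dist p pb < \<delta> \<longrightarrow>
        (\<forall>w\<in>X. norm (D x p w - D xb pb w) \<le> \<epsilon> * norm w)"
    using fr unfolding uniformly_frechet_at_def by blast
  obtain e e' where e: "e > 0" "X \<inter> ball xb e \<subseteq> U" "e' > 0" "ball pb e' \<subseteq> P"
    using n by (auto simp: nbhd_in_iff_ball)
  obtain \<delta> where \<delta>: "\<delta> > 0" "\<And>x p w. x \<in> X \<Longrightarrow> dist x xb < \<delta> \<Longrightarrow> dist p pb < \<delta> \<Longrightarrow> w \<in> X \<Longrightarrow>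
      norm (D x p w - D xb pb w) \<le> \<epsilon> * norm w"
    using cont \<open>0 < \<epsilon>\<close> by (metis dist_norm)
  define r where "r = min \<delta> (min e e')"
  interpret A: bounded_linear "D xb pb" by (rule uniformly_frechet_bounded_linear[OF fr])
  have "norm (f x1 p - f x2 p - D xb pb (x1 - x2)) \<le> \<epsilon> * norm (x1 - x2)"
    if x: "x1 \<in> X" "x2 \<in> X" "dist x1 xb < r" "dist x2 xb < r" and p: "dist p pb < r" for x1 x2 p
  proof -
    define c where "c s = x2 + s *\<^sub>R (x1 - x2)" for s :: real
    define g where "g s = f (c s) p - D xb pb (c s)" for s
    have c: "c s \<in> X" "dist (c s) xb < r" if "s \<in> {0..1}" for s
    proof -
      show "c s \<in> X" unfolding c_def using X x by (intro subspace_add subspace_scale subspace_diff)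
      have "c s = (1 - s) *\<^sub>R x2 + s *\<^sub>R x1" by (simp add: c_def algebra_simps)
      moreover have "(1 - s) *\<^sub>R x2 + s *\<^sub>R x1 \<in> ball xb r"
        using x that by (intro convexD convex_ball) (auto simp: dist_commute)
      ultimately show "dist (c s) xb < r" by (simp add: dist_commute)
    qed
    have "(g has_derivative (\<lambda>h. D (c s) p (h *\<^sub>R (x1 - x2)) - D xb pb (h *\<^sub>R (x1 - x2))))
        (at s within {0..1})" if s: "s \<in> {0..1}" for s
    proof -
      have c': "(c has_derivative (\<lambda>h. h *\<^sub>R (x1 - x2))) (at s within {0..1})"
        unfolding c_def by (auto intro!: derivative_eq_intros)
      have "((\<lambda>z. f z p) has_derivative D (c s) p) (at (c s) within X)"
        using der c[OF s] p e by (auto simp: r_def subset_iff dist_commute)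
      then have "((\<lambda>z. f z p) has_derivative D (c s) p) (at (c s) within c ` {0..1})"
        by (rule has_derivative_subset) (use c in auto)
      from has_derivative_in_compose[OF c' this]
      have "((\<lambda>s. f (c s) p) has_derivative (\<lambda>h. D (c s) p (h *\<^sub>R (x1 - x2)))) (at s within {0..1})" .
      then show ?thesis
        unfolding g_def by (intro has_derivative_diff A.has_derivative c')
    qed
    moreover have "onorm (\<lambda>h. D (c s) p (h *\<^sub>R (x1 - x2)) - D xb pb (h *\<^sub>R (x1 - x2)))
        \<le> \<epsilon> * norm (x1 - x2)" if s: "s \<in> {0..1}" for s :: real
    proof (rule onorm_le)
      fix h :: real
      have "h *\<^sub>R (x1 - x2) \<in> X" using X x by (intro subspace_scale subspace_diff)
      then have "norm (D (c s) p (h *\<^sub>R (x1 - x2)) - D xb pb (h *\<^sub>R (x1 - x2)))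
          \<le> \<epsilon> * norm (h *\<^sub>R (x1 - x2))"
        using c[OF s] p by (intro \<delta>) (auto simp: r_def)
      then show "norm (D (c s) p (h *\<^sub>R (x1 - x2)) - D xb pb (h *\<^sub>R (x1 - x2)))
          \<le> \<epsilon> * norm (x1 - x2) * norm h"
        by (simp add: mult_ac)
    qed
    ultimately have "norm (g 1 - g 0) \<le> \<epsilon> * norm (x1 - x2) * norm (1 - 0 :: real)"
      by (intro differentiable_bound[where S = "{0..1}"]) auto
    then show ?thesis by (simp add: g_def c_def A.diff algebra_simps)
  qed
  then show ?thesis using \<delta>(1) e by (intro exI[of _ r]) (auto simp: r_def)
qed

section \<open>Pointwise constraints and their normal cones\<close>

lemma l2_realise:
  assumes [measurable]: "g \<in> borel_measurable lebesgue"
    and "AE y in lebesgue. \<bar>g y\<bar> \<le> \<bar>l2_fun x y\<bar> + \<bar>l2_fun z y\<bar>"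
  shows "\<exists>c. AE y in lebesgue. l2_fun c y = g y"
proof -
  have "integrable lebesgue (\<lambda>y. (g y)\<^sup>2)"
  proof (rule Bochner_Integration.integrable_bound)
    show "integrable lebesgue (\<lambda>y. 2 * (l2_fun x y)\<^sup>2 + 2 * (l2_fun z y)\<^sup>2)"
      using square_integrable_l2_fun[of x] square_integrable_l2_fun[of z]
      by (auto simp: square_integrable_def)
    show "AE y in lebesgue. norm ((g y)\<^sup>2) \<le> norm (2 * (l2_fun x y)\<^sup>2 + 2 * (l2_fun z y)\<^sup>2)"
      using assms(2)
    proof eventually_elim
      case (elim y)
      then have "\<bar>g y\<bar>\<^sup>2 \<le> (\<bar>l2_fun x y\<bar> + \<bar>l2_fun z y\<bar>)\<^sup>2" by (intro power_mono) auto
      moreover have "0 \<le> (\<bar>l2_fun x y\<bar> - \<bar>l2_fun z y\<bar>)\<^sup>2" by simp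
      ultimately show ?case by (simp add: power2_sum power2_diff)
    qed
  qed measurable
  then have "square_integrable g" by (simp add: square_integrable_def)
  then show ?thesis using l2_fun_abs_l2 by blast
qed

lemma l2_inner_mono:
  assumes "AE y in lebesgue. l2_fun x y * l2_fun z y \<le> l2_fun x' y * l2_fun z' y"
  shows "x \<bullet> z \<le> x' \<bullet> z'"
  unfolding inner_l2_def using assms by (intro integral_mono_AE integrable_l2_fun_mult)

lemma l2_inner_cong:
  assumes "AE y in lebesgue. l2_fun x y * l2_fun z y = l2_fun x' y * l2_fun z' y"
  shows "x \<bullet> z = x' \<bullet> z'"
  by (intro antisym l2_inner_mono; use assms in \<open>eventually_elim\<close>; simp)

lemma l2_norm_mono:
  assumes "AE y in lebesgue. \<bar>l2_fun x y\<bar> \<le> \<bar>l2_fun z y\<bar>"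
  shows "norm x \<le> norm z"
proof (rule power2_le_imp_le)
  show "(norm x)\<^sup>2 \<le> (norm z)\<^sup>2"
    unfolding power2_norm_eq_inner
    by (rule l2_inner_mono) (use assms in eventually_elim, simp add: abs_le_square_iff flip: power2_eq_square)
qed simp

lemma l2_inner_nonneg:
  assumes "AE y in lebesgue. 0 \<le> l2_fun x y * l2_fun z y"
  shows "0 \<le> x \<bullet> z"
  unfolding inner_l2_def using assms by (rule integral_nonneg_AE)

lemma l2_inner_nonpos_imp_AE_zero:
  assumes "AE y in lebesgue. 0 \<le> l2_fun x y * l2_fun z y" "x \<bullet> z \<le> 0"
  shows "AE y in lebesgue. l2_fun x y * l2_fun z y = 0"
proof -
  have "x \<bullet> z = 0" using assms l2_inner_nonneg[OF assms(1)] by simp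
  then show ?thesis
    unfolding inner_l2_def using integral_nonneg_eq_0_iff_AE[OF integrable_l2_fun_mult assms(1)] by simp
qed

text \<open>
  The witness is \<open>\<bar>x\<bar> sgn w\<close>. It turns the integral of \<open>\<bar>x w\<bar>\<close> into an inner product, to which weak
  convergence applies.
\<close>

lemma l2_sign_alignment:
  "\<exists>s. (AE y in lebesgue. \<bar>l2_fun s y\<bar> \<le> \<bar>l2_fun x y\<bar>) \<and>
       (AE y in lebesgue. l2_fun s y * l2_fun w y = \<bar>l2_fun x y * l2_fun w y\<bar>)"
proof -
  let ?g = "\<lambda>y. if 0 \<le> l2_fun w y then \<bar>l2_fun x y\<bar> else - \<bar>l2_fun x y\<bar>"
  have "\<exists>s. AE y in lebesgue. l2_fun s y = ?g y"
    by (rule l2_realise[of _ x x]) auto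
  then obtain s where s: "AE y in lebesgue. l2_fun s y = ?g y" by blast
  have "AE y in lebesgue. \<bar>l2_fun s y\<bar> \<le> \<bar>l2_fun x y\<bar>"
    using s by eventually_elim auto
  moreover have "AE y in lebesgue. l2_fun s y * l2_fun w y = \<bar>l2_fun x y * l2_fun w y\<bar>"
    using s by eventually_elim (auto simp: abs_mult)
  ultimately show ?thesis by blast
qed

text \<open>
  Pointwise \<open>\<bar>z w\<bar> \<le> \<bar>u w\<bar> \<le> u1 w + \<bar>u - u1\<bar> \<bar>w\<bar>\<close>; the last product is integrated after aligning
  signs.
\<close>

lemma inner_le_aligned_inner:
  assumes "AE y in lebesgue. 0 \<le> l2_fun u1 y * l2_fun w y"
    and "AE y in lebesgue. \<bar>l2_fun z y\<bar> \<le> \<bar>l2_fun u y\<bar>"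
  shows "z \<bullet> w \<le> u1 \<bullet> w + norm (u - u1) * norm w"
proof -
  obtain s where s: "AE y in lebesgue. \<bar>l2_fun s y\<bar> \<le> \<bar>l2_fun (u - u1) y\<bar>"
    "AE y in lebesgue. l2_fun s y * l2_fun w y = \<bar>l2_fun (u - u1) y * l2_fun w y\<bar>"
    using l2_sign_alignment by blast
  have "z \<bullet> w \<le> (u1 + s) \<bullet> w"
  proof (rule l2_inner_mono)
    show "AE y in lebesgue. l2_fun z y * l2_fun w y \<le> l2_fun (u1 + s) y * l2_fun w y"
      using assms s(2) l2_fun_add[of u1 s] l2_fun_diff[of u u1]
    proof eventually_elim
      case (elim y)
      have "l2_fun z y * l2_fun w y \<le> \<bar>l2_fun z y\<bar> * \<bar>l2_fun w y\<bar>"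
        by (metis abs_ge_self abs_mult)
      also have "\<dots> \<le> (\<bar>l2_fun u1 y\<bar> + \<bar>l2_fun u y - l2_fun u1 y\<bar>) * \<bar>l2_fun w y\<bar>"
        using elim(2) by (intro mult_right_mono) auto
      also have "\<dots> = \<bar>l2_fun u1 y * l2_fun w y\<bar> + \<bar>(l2_fun u y - l2_fun u1 y) * l2_fun w y\<bar>"
        by (simp only: abs_mult distrib_right)
      also have "\<dots> = l2_fun (u1 + s) y * l2_fun w y"
        using elim by (simp add: distrib_right)
      finally show ?case .
    qed
  qed
  also have "\<dots> = u1 \<bullet> w + s \<bullet> w" by (simp add: inner_add_left)
  also have "s \<bullet> w \<le> norm (u - u1) * norm w"
    using order_trans[OF norm_cauchy_schwarz mult_right_mono[OF l2_norm_mono[OF s(1)] norm_ge_zero]] .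
  finally show ?thesis by simp
qed

text \<open>
  The box is treated through the set \<open>I\<close> of admissible values, so that infinite bounds need no case
  distinctions.
\<close>

definition L2_in :: "'a::euclidean_space set \<Rightarrow> real set \<Rightarrow> 'a l2 set" where
  "L2_in \<Omega> I = {x \<in> L2 \<Omega>. AE y in lebesgue. y \<in> \<Omega> \<longrightarrow> l2_fun x y \<in> I}"

lemma L2_in_subset: "L2_in \<Omega> I \<subseteq> L2 \<Omega>"
  by (auto simp: L2_in_def)

text \<open>
  Membership as one almost-everywhere condition on the whole space, the value \<open>0\<close> outside \<open>\<Omega>\<close>
  included; in this form it combines with other pointwise facts.
\<close>

lemma L2_in_I:
  assumes "AE y in lebesgue. l2_fun c y \<in> (if y \<in> \<Omega> then I else {0})"
  shows "c \<in> L2_in \<Omega> I"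
proof -
  have "AE y in lebesgue. y \<notin> \<Omega> \<longrightarrow> l2_fun c y = 0" "AE y in lebesgue. y \<in> \<Omega> \<longrightarrow> l2_fun c y \<in> I"
    using assms by (eventually_elim; simp split: if_splits)+
  then show ?thesis by (simp add: L2_in_def L2_def)
qed

lemma L2_inD:
  assumes "c \<in> L2_in \<Omega> I"
  shows "AE y in lebesgue. l2_fun c y \<in> (if y \<in> \<Omega> then I else {0})"
proof -
  have "AE y in lebesgue. y \<notin> \<Omega> \<longrightarrow> l2_fun c y = 0" "AE y in lebesgue. y \<in> \<Omega> \<longrightarrow> l2_fun c y \<in> I"
    using assms by (auto simp: L2_in_def L2_def)
  then show ?thesis by eventually_elim simp
qed

lemma convex_L2_in:
  assumes "convex I"
  shows "convex (L2_in \<Omega> I)"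
proof (rule convexI)
  fix x z and u v :: real
  assume *: "x \<in> L2_in \<Omega> I" "z \<in> L2_in \<Omega> I" "0 \<le> u" "0 \<le> v" "u + v = 1"
  show "u *\<^sub>R x + v *\<^sub>R z \<in> L2_in \<Omega> I"
    apply (rule L2_in_I)
    using L2_inD[OF *(1)] L2_inD[OF *(2)] l2_fun_add[of "u *\<^sub>R x" "v *\<^sub>R z"]
      l2_fun_scaleR[of u x] l2_fun_scaleR[of v z]
  proof eventually_elim
    case (elim y)
    show ?case
    proof (cases "y \<in> \<Omega>")
      case True
      then show ?thesis
        using elim convexD[OF assms, of "l2_fun x y" "l2_fun z y" u v] * by simp
    qed (use elim in simp)
  qed
qed

text \<open>
  The pointwise distance to \<open>I\<close> is a square-integrable function whose norm is at most the distance of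
  \<open>x\<close> to any member of the set, hence zero for a limit \<open>x\<close>.
\<close>

lemma closed_L2_in:
  assumes \<Omega>: "\<Omega> \<in> sets lebesgue" and "closed I" "I \<noteq> {}"
  shows "closed (L2_in \<Omega> I)"
  unfolding closed_sequential_limits
proof (intro allI impI, elim conjE)
  fix s x assume s: "\<forall>n. s n \<in> L2_in \<Omega> I" and lim: "s \<longlonglongrightarrow> x"
  have "x \<in> L2 \<Omega>"
    using closed_sequentially[OF closed_L2[OF \<Omega>] _ lim] s L2_in_subset by blast
  define g where "g y = (if y \<in> \<Omega> then infdist (l2_fun x y) I else 0)" for y
  have [measurable]: "(\<lambda>y. infdist (l2_fun x y) I) \<in> borel_measurable lebesgue"
    by (rule measurable_compose[OF borel_measurable_l2_fun])
       (intro borel_measurable_continuous_onI continuous_intros)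
  have g_meas: "g \<in> borel_measurable lebesgue"
    unfolding g_def by (rule measurable_If_set) (use \<Omega> in auto)
  have le: "AE y in lebesgue. \<bar>g y\<bar> \<le> \<bar>l2_fun (x - s n) y\<bar>" for n
    using L2_inD[OF s[rule_format, of n]] l2_fun_diff[of x "s n"]
  proof eventually_elim
    case (elim y)
    then show ?case
      using infdist_le[of "l2_fun (s n) y" I "l2_fun x y"]
      by (auto simp: g_def infdist_nonneg dist_real_def)
  qed
  have "AE y in lebesgue. \<bar>g y\<bar> \<le> \<bar>l2_fun (x - s 0) y\<bar> + \<bar>l2_fun 0 y\<bar>"
    using le[of 0] by eventually_elim simp
  then obtain c where c: "AE y in lebesgue. l2_fun c y = g y"
    using l2_realise[OF g_meas] by blast
  have "norm c \<le> norm (x - s n)" for n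
    by (rule l2_norm_mono) (use c le[of n] in eventually_elim, simp)
  moreover have "(\<lambda>n. norm (x - s n)) \<longlonglongrightarrow> norm (x - x)" by (intro tendsto_intros lim)
  ultimately have "norm c \<le> norm (x - x)" by (intro LIMSEQ_le_const) auto
  then have "c = 0" by simp
  have "AE y in lebesgue. y \<in> \<Omega> \<longrightarrow> l2_fun x y \<in> I"
    using c l2_fun_0[where 'a = 'a] unfolding \<open>c = 0\<close>
  proof eventually_elim
    case (elim y)
    then have "infdist (l2_fun x y) I = 0" if "y \<in> \<Omega>" using that by (simp add: g_def)
    then show ?case unfolding in_closed_iff_infdist_zero[OF assms(2,3)] by blast
  qed
  then show "x \<in> L2_in \<Omega> I" using \<open>x \<in> L2 \<Omega>\<close> by (simp add: L2_in_def)
qed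

text \<open>
  The set is decomposable: switching from \<open>x\<close> to \<open>c\<close> exactly where this would increase the product with
  \<open>u\<close> stays in it, and the normal cone inequality for the result leaves no room for such points.
\<close>

lemma normal_cone_L2_in_pointwise:
  assumes u: "u \<in> normal_cone (L2 \<Omega>) (L2_in \<Omega> I) x" and c: "c \<in> L2_in \<Omega> I"
  shows "AE y in lebesgue. l2_fun u y * l2_fun (x - c) y \<ge> 0"
proof -
  have x: "x \<in> L2_in \<Omega> I" using normal_coneD(2)[OF u] .
  let ?g = "\<lambda>y. if 0 < l2_fun u y * (l2_fun c y - l2_fun x y) then l2_fun c y else l2_fun x y"
  obtain e where e: "AE y in lebesgue. l2_fun e y = ?g y"
    using l2_realise[of ?g x c] by (force intro!: measurable_If)
  have "e \<in> L2_in \<Omega> I"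
    by (rule L2_in_I) (use e L2_inD[OF x] L2_inD[OF c] in eventually_elim, auto split: if_splits)
  with u have "u \<bullet> (e - x) \<le> 0" by (rule normal_coneD)
  moreover have diff: "AE y in lebesgue. l2_fun u y * l2_fun (e - x) y
      = max 0 (l2_fun u y * (l2_fun c y - l2_fun x y))"
    using e l2_fun_diff[of e x] by eventually_elim auto
  then have "AE y in lebesgue. 0 \<le> l2_fun u y * l2_fun (e - x) y"
    by eventually_elim simp
  ultimately have "AE y in lebesgue. l2_fun u y * l2_fun (e - x) y = 0"
    by (rule l2_inner_nonpos_imp_AE_zero[rotated])
  then show ?thesis
    using diff l2_fun_diff[of x c]
  proof eventually_elim
    case (elim y)
    then have "l2_fun u y * (l2_fun c y - l2_fun x y) \<le> 0" by linarith
    then show ?case unfolding elim(3) by (simp add: right_diff_distrib)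
  qed
qed

lemma normal_cone_transfer:
  assumes u: "u \<in> normal_cone X C x" and "z \<in> C"
    and "AE y in lebesgue. l2_fun u y * l2_fun (z - x) y = 0"
  shows "u \<in> normal_cone X C z"
proof -
  have "u \<bullet> (z - x) = 0 \<bullet> (z - x)"
    by (rule l2_inner_cong) (use assms(3) l2_fun_0 in eventually_elim, simp)
  then have "u \<bullet> (c - z) = u \<bullet> (c - x)" for c by (simp add: inner_diff_right)
  then show ?thesis using assms normal_coneD[OF u] by (simp add: normal_cone_def)
qed

section \<open>Positivity on the critical subspace implies local strong monotonicity\<close>

text \<open>
  This is where the Legendre property enters. The proof is by contradiction, through a weak limit \<open>w0\<close>
  of normalised differences \<open>w\<close> of points at which the inequality fails for \<open>\<kappa> = r = 1 / (n + 1)\<close>.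
\<close>

lemma legendre_form_local_growth:
  fixes \<Omega> :: "'a::euclidean_space set"
  assumes \<Omega>: "\<Omega> \<in> sets lebesgue"
    and A: "bounded_linear A" and leg: "legendre_form (L2 \<Omega>) (\<lambda>w. A w \<bullet> w)"
    and pos: "\<And>w. w \<in> L2 \<Omega> \<Longrightarrow> w \<noteq> 0 \<Longrightarrow> (AE y in lebesgue. l2_fun u y * l2_fun w y = 0) \<Longrightarrow> 0 < A w \<bullet> w"
  shows "\<exists>\<kappa>>0. \<exists>r>0. \<forall>x1 x2. \<forall>u1\<in>normal_cone (L2 \<Omega>) (L2_in \<Omega> I) x1. \<forall>u2\<in>normal_cone (L2 \<Omega>) (L2_in \<Omega> I) x2.
     dist x1 xb < r \<and> dist x2 xb < r \<and> dist u1 u < r \<and> dist u2 u < r \<longrightarrow>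
       \<kappa> * (norm (x1 - x2))\<^sup>2 \<le> (A (x1 - x2) + (u1 - u2)) \<bullet> (x1 - x2)"
proof (rule ccontr)
  let ?N = "normal_cone (L2 \<Omega>) (L2_in \<Omega> I)"
  interpret A: bounded_linear A by (rule A)
  define Q where "Q w = A w \<bullet> w" for w
  define \<delta> where "\<delta> n = 1 / real (Suc n)" for n
  have \<delta>: "0 < \<delta> n" "\<delta> n \<le> 1" for n by (auto simp: \<delta>_def)
  have \<delta>0: "\<delta> \<longlonglongrightarrow> 0" unfolding \<delta>_def by (intro lim_inverse_n' LIMSEQ_Suc)
  assume neg: "\<not> ?thesis"
  have "\<exists>x1 x2 u1 u2. u1 \<in> ?N x1 \<and> u2 \<in> ?N x2 \<and>
      dist x1 xb < \<delta> n \<and> dist x2 xb < \<delta> n \<and> dist u1 u < \<delta> n \<and>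
      (A (x1 - x2) + (u1 - u2)) \<bullet> (x1 - x2) < \<delta> n * (norm (x1 - x2))\<^sup>2" for n
    using neg \<delta>(1)[of n] by (meson not_le)
  then obtain X1 X2 U1 U2 where U1: "\<And>n. U1 n \<in> ?N (X1 n)" and U2: "\<And>n. U2 n \<in> ?N (X2 n)"
    and close: "\<And>n. dist (X1 n) xb < \<delta> n" "\<And>n. dist (X2 n) xb < \<delta> n" "\<And>n. dist (U1 n) u < \<delta> n"
    and small: "\<And>n. (A (X1 n - X2 n) + (U1 n - U2 n)) \<bullet> (X1 n - X2 n) < \<delta> n * (norm (X1 n - X2 n))\<^sup>2"
    by metis
  define t where "t n = norm (X1 n - X2 n)" for n
  define w where "w n = (1 / t n) *\<^sub>R (X1 n - X2 n)" for n
  have XL: "X1 n \<in> L2_in \<Omega> I" "X2 n \<in> L2_in \<Omega> I" for n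
    using normal_coneD(2)[OF U1] normal_coneD(2)[OF U2] .
  have t_pos: "0 < t n" for n using small[of n] by (cases "X1 n = X2 n") (auto simp: t_def)
  have t_le: "t n \<le> 2 * \<delta> n" for n
    using dist_triangle2[of "X1 n" "X2 n" xb] close(1,2)[of n] by (simp add: t_def dist_norm)
  have d_eq: "X1 n - X2 n = t n *\<^sub>R w n" for n using t_pos[of n] by (simp add: w_def)
  have norm_w: "norm (w n) = 1" for n using t_pos[of n] by (simp add: w_def t_def)
  have wL: "w n \<in> L2 \<Omega>" for n
    unfolding w_def using XL[of n] L2_in_subset[of \<Omega> I] subspace_L2[of \<Omega>]
    by (intro subspace_scale subspace_diff) auto
  have U1_sign: "AE y in lebesgue. 0 \<le> l2_fun (U1 n) y * l2_fun (w n) y" for n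
    using normal_cone_L2_in_pointwise[OF U1 XL(2), of n n]
      l2_fun_scaleR[of "1 / t n" "X1 n - X2 n"] unfolding w_def
  proof eventually_elim
    case (elim y)
    then show ?case using t_pos[of n] by (simp add: zero_le_mult_iff zero_le_divide_iff)
  qed
  \<comment> \<open>The violated inequality, divided by the square of the distance \<open>t n\<close>.\<close>
  have "Q (w n) + (U1 n \<bullet> w n - U2 n \<bullet> w n) / t n < \<delta> n" for n
  proof -
    have "t n * t n * (Q (w n) + (U1 n \<bullet> w n - U2 n \<bullet> w n) / t n)
        = (A (X1 n - X2 n) + (U1 n - U2 n)) \<bullet> (X1 n - X2 n)"
      unfolding d_eq Q_def using t_pos[of n]
      by (simp add: A.scaleR inner_add_left inner_diff_left field_simps)
    also have "\<dots> < t n * t n * \<delta> n"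
      using small[of n] by (simp add: t_def[symmetric] power2_eq_square mult_ac)
    finally show ?thesis using t_pos[of n] by simp
  qed
  moreover have "U2 n \<bullet> w n \<le> 0" for n
    using normal_coneD(3)[OF U2 XL(1), of n n] t_pos[of n] by (simp add: w_def divide_nonpos_pos)
  moreover have U1w: "0 \<le> U1 n \<bullet> w n" for n by (rule l2_inner_nonneg[OF U1_sign])
  ultimately have main: "Q (w n) + (U1 n \<bullet> w n) / t n < \<delta> n" for n
    using t_pos[of n] by (smt (verit) divide_right_mono)
  then have Q_small: "Q (w n) < \<delta> n" for n
    using U1w[of n] t_pos[of n] by (smt (verit) divide_nonneg_pos)
  obtain M where M: "0 \<le> M" "\<And>x. norm (A x) \<le> norm x * M" using A.nonneg_bounded by blast
  have Q_low: "- M \<le> Q (w n)" for n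
    using Cauchy_Schwarz_ineq2[of "A (w n)" "w n"] M(2)[of "w n"] norm_w[of n] by (simp add: Q_def)
  \<comment> \<open>The division by \<open>t n\<close> in \<open>main\<close> forces the inner product to vanish in the limit.\<close>
  have U1w_le: "U1 n \<bullet> w n \<le> (1 + M) * (2 * \<delta> n)" for n
  proof -
    have "(U1 n \<bullet> w n) / t n \<le> 1 + M" using main[of n] Q_low[of n] \<delta>[of n] by simp
    then have "U1 n \<bullet> w n \<le> (1 + M) * t n" using t_pos[of n] by (simp add: field_simps)
    also have "\<dots> \<le> (1 + M) * (2 * \<delta> n)" using t_le M by (intro mult_left_mono) auto
    finally show ?thesis .
  qed
  obtain w0 r where w0: "w0 \<in> L2 \<Omega>" and r: "strict_mono r"
    and weak: "\<And>z. (\<lambda>k. w (r k) \<bullet> z) \<longlonglongrightarrow> w0 \<bullet> z"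
    using bounded_imp_weakly_convergent_subsequence[OF subspace_L2 closed_L2[OF \<Omega>], of w] wL norm_w
    by (auto simp: bounded_iff)
  have range_w: "range (\<lambda>k. w (r k)) \<subseteq> L2 \<Omega>" using wL by auto
  have weak': "limitin (weak_topology (L2 \<Omega>)) (\<lambda>k. w (r k)) w0 sequentially"
    by (rule limitin_weak_topology[OF range_w w0 weak])
  have \<delta>r: "(\<lambda>k. \<delta> (r k)) \<longlonglongrightarrow> 0" using LIMSEQ_subseq_LIMSEQ[OF \<delta>0 r] by (simp add: o_def)
  have lsc: "weakly_lsc (L2 \<Omega>) Q" using leg unfolding legendre_form_def Q_def by blast
  \<comment> \<open>The weak limit is critical.\<close>
  have "AE y in lebesgue. l2_fun u y * l2_fun w0 y = 0"
  proof -
    obtain z where z: "AE y in lebesgue. \<bar>l2_fun z y\<bar> \<le> \<bar>l2_fun u y\<bar>"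
      "AE y in lebesgue. l2_fun z y * l2_fun w0 y = \<bar>l2_fun u y * l2_fun w0 y\<bar>"
      using l2_sign_alignment by blast
    have "w (r k) \<bullet> z \<le> (2 * (1 + M) + 1) * \<delta> (r k)" for k
    proof -
      have "z \<bullet> w (r k) \<le> U1 (r k) \<bullet> w (r k) + norm (u - U1 (r k)) * norm (w (r k))"
        by (rule inner_le_aligned_inner[OF U1_sign z(1)])
      also have "\<dots> \<le> (1 + M) * (2 * \<delta> (r k)) + \<delta> (r k)"
        using U1w_le[of "r k"] close(3)[of "r k"] norm_w
        by (intro add_mono) (simp_all add: dist_norm norm_minus_commute)
      finally show ?thesis by (simp add: inner_commute algebra_simps)
    qed
    moreover have "(\<lambda>k. (2 * (1 + M) + 1) * \<delta> (r k)) \<longlonglongrightarrow> (2 * (1 + M) + 1) * 0"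
      by (intro tendsto_intros \<delta>r)
    ultimately have "w0 \<bullet> z \<le> (2 * (1 + M) + 1) * 0"
      by (intro LIMSEQ_le[OF weak]) auto
    then have "z \<bullet> w0 \<le> 0" by (simp add: inner_commute)
    moreover have "AE y in lebesgue. 0 \<le> l2_fun z y * l2_fun w0 y"
      using z(2) by eventually_elim simp
    ultimately have "AE y in lebesgue. l2_fun z y * l2_fun w0 y = 0"
      by (intro l2_inner_nonpos_imp_AE_zero)
    then show ?thesis using z(2) by eventually_elim simp
  qed
  moreover have "Q w0 \<le> 0"
  proof (rule ccontr)
    assume "\<not> Q w0 \<le> 0"
    then have "\<forall>\<^sub>F k in sequentially. Q w0 / 2 < Q (w (r k))"
      by (intro weakly_lsc_eventually_less[OF lsc weak' range_w]) simp
    then have "\<forall>\<^sub>F k in sequentially. Q w0 / 2 \<le> \<delta> (r k)"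
      by eventually_elim (use Q_small in \<open>meson less_trans less_imp_le\<close>)
    then have "Q w0 / 2 \<le> 0" by (intro tendsto_lowerbound[OF \<delta>r]) auto
    then show False using \<open>\<not> Q w0 \<le> 0\<close> by simp
  qed
  ultimately have "w0 = 0" using pos[OF w0] unfolding Q_def by force
  have "(\<lambda>k. Q (w (r k))) \<longlonglongrightarrow> Q w0"
  proof (rule order_tendstoI)
    fix \<alpha> assume "\<alpha> < Q w0"
    then show "\<forall>\<^sub>F k in sequentially. \<alpha> < Q (w (r k))"
      by (rule weakly_lsc_eventually_less[OF lsc weak' range_w])
  next
    fix \<alpha> assume "Q w0 < \<alpha>"
    then have "0 < \<alpha>" by (simp add: \<open>w0 = 0\<close> Q_def)
    then have "\<forall>\<^sub>F k in sequentially. \<delta> (r k) < \<alpha>" using order_tendstoD(2)[OF \<delta>r] by blast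
    then show "\<forall>\<^sub>F k in sequentially. Q (w (r k)) < \<alpha>"
      by eventually_elim (use Q_small in \<open>meson less_trans\<close>)
  qed
  then have "(\<lambda>k. w (r k)) \<longlonglongrightarrow> w0"
    using leg range_w w0 weak' unfolding legendre_form_def Q_def by blast
  then have "(\<lambda>k. norm (w (r k))) \<longlonglongrightarrow> norm w0" by (rule tendsto_norm)
  then show False unfolding norm_w \<open>w0 = 0\<close> using LIMSEQ_unique[OF tendsto_const] by fastforce
qed

text \<open>
  Strict differentiability transfers the growth inequality from \<open>A\<close> to \<open>f(\<cdot>, p)\<close> at the price of half of
  the modulus.
\<close>

lemma critical_positivity_imp_locally_strongly_monotone:
  fixes f :: "'a::euclidean_space l2 \<Rightarrow> 'p::metric_space \<Rightarrow> 'a l2"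
  assumes \<Omega>: "\<Omega> \<in> sets lebesgue" and fr: "uniformly_frechet_at (L2 \<Omega>) f D xb pb"
    and leg: "legendre_form (L2 \<Omega>) (\<lambda>w. D xb pb w \<bullet> w)"
    and pos: "\<And>w. w \<in> L2 \<Omega> \<Longrightarrow> w \<noteq> 0 \<Longrightarrow> (AE y in lebesgue. l2_fun u y * l2_fun w y = 0) \<Longrightarrow>
      0 < D xb pb w \<bullet> w"
  shows "locally_strongly_monotone (L2 \<Omega>) (L2_in \<Omega> I) f u xb pb"
proof -
  let ?N = "normal_cone (L2 \<Omega>) (L2_in \<Omega> I)"
  obtain \<kappa> r where \<kappa>: "\<kappa> > 0" "r > 0" and growth:
    "\<And>x1 x2 u1 u2. \<lbrakk>u1 \<in> ?N x1; u2 \<in> ?N x2; dist x1 xb < r; dist x2 xb < r; dist u1 u < r; dist u2 u < r\<rbrakk>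
      \<Longrightarrow> \<kappa> * (norm (x1 - x2))\<^sup>2 \<le> (D xb pb (x1 - x2) + (u1 - u2)) \<bullet> (x1 - x2)"
    using legendre_form_local_growth[OF \<Omega> uniformly_frechet_bounded_linear[OF fr] leg pos, of u I xb]
    by blast
  obtain r' where r': "r' > 0" and strict:
    "\<And>x1 x2 p. \<lbrakk>x1 \<in> L2 \<Omega>; x2 \<in> L2 \<Omega>; dist x1 xb < r'; dist x2 xb < r'; dist p pb < r'\<rbrakk> \<Longrightarrow>
      norm (f x1 p - f x2 p - D xb pb (x1 - x2)) \<le> (\<kappa> / 2) * norm (x1 - x2)"
    using uniformly_frechet_strict[OF subspace_L2 fr, of "\<kappa> / 2"] \<kappa> by auto
  have "\<kappa> / 2 * (norm (x1 - x2))\<^sup>2 \<le> (f x1 p - f x2 p + (u1 - u2)) \<bullet> (x1 - x2)"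
    if u: "u1 \<in> ?N x1" "u2 \<in> ?N x2" "dist u1 u < min r r'" "dist u2 u < min r r'"
      and x: "dist x1 xb < min r r'" "dist x2 xb < min r r'" and p: "dist p pb < min r r'"
    for p x1 x2 u1 u2
  proof -
    have xL: "x1 \<in> L2 \<Omega>" "x2 \<in> L2 \<Omega>"
      using normal_coneD(2)[OF u(1)] normal_coneD(2)[OF u(2)] L2_in_subset by auto
    define e where "e = f x1 p - f x2 p - D xb pb (x1 - x2)"
    have "norm e \<le> (\<kappa> / 2) * norm (x1 - x2)"
      unfolding e_def using x p xL by (intro strict) auto
    then have "norm e * norm (x1 - x2) \<le> (\<kappa> / 2 * norm (x1 - x2)) * norm (x1 - x2)"
      by (rule mult_right_mono) simp
    then have "- (e \<bullet> (x1 - x2)) \<le> \<kappa> / 2 * (norm (x1 - x2))\<^sup>2"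
      using Cauchy_Schwarz_ineq2[of e "x1 - x2"] by (simp add: power2_eq_square)
    moreover have "\<kappa> * (norm (x1 - x2))\<^sup>2 \<le> (D xb pb (x1 - x2) + (u1 - u2)) \<bullet> (x1 - x2)"
      using u x by (intro growth) auto
    moreover have "(f x1 p - f x2 p + (u1 - u2)) \<bullet> (x1 - x2)
        = (D xb pb (x1 - x2) + (u1 - u2)) \<bullet> (x1 - x2) + e \<bullet> (x1 - x2)"
      by (simp add: e_def inner_add_left inner_diff_left)
    ultimately show ?thesis by simp
  qed
  then show ?thesis
    unfolding locally_strongly_monotone_def using \<kappa> r'
    by (intro exI[of _ "\<kappa> / 2"] exI[of _ "min r r'"] conjI) auto
qed

section \<open>Full stability implies positivity on the critical subspace\<close>

text \<open>
  A critical direction need not point into the constraint set from \<open>x\<close>. If a step \<open>s\<close> is at most half as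
  long as \<open>[\<alpha>, \<beta>]\<close>, then from every point of \<open>I\<close> at least one of the steps \<open>s\<close> and \<open>-s\<close> stays in \<open>I\<close>,
  depending on the side of the midpoint of \<open>[\<alpha>, \<beta>]\<close> on which the point lies. Taking as base point \<open>x\<close> in the first case
  and \<open>x - t w\<close> in the second, pointwise, gives the segment.
\<close>

lemma L2_in_segment_along:
  assumes x: "x \<in> L2_in \<Omega> I" and w: "w \<in> L2 \<Omega>" "AE y in lebesgue. \<bar>l2_fun w y\<bar> \<le> B"
    and I: "convex I" "I \<in> sets borel" "\<alpha> \<in> I" "\<beta> \<in> I" and t: "0 \<le> t" "2 * (t * B) \<le> \<beta> - \<alpha>"
  shows "\<exists>z. z \<in> L2_in \<Omega> I \<and> z + t *\<^sub>R w \<in> L2_in \<Omega> I \<and> norm (z - x) \<le> t * norm w \<and>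
    (AE y in lebesgue. l2_fun w y = 0 \<longrightarrow> l2_fun (z - x) y = 0)"
proof -
  let ?g = "\<lambda>y. if l2_fun x y + t * l2_fun w y \<in> I then l2_fun x y else l2_fun x y - t * l2_fun w y"
  have move: "p + s \<in> I \<or> p - s \<in> I" if p: "p \<in> I" and s: "2 * \<bar>s\<bar> \<le> \<beta> - \<alpha>" for p s
  proof -
    have int: "q \<in> I" if "q1 \<in> I" "q2 \<in> I" "q1 \<le> q" "q \<le> q2" for q q1 q2
      using \<open>convex I\<close> that unfolding is_interval_convex_1[symmetric] is_interval_1 by blast
    show ?thesis
    proof (cases "p \<le> (\<alpha> + \<beta>) / 2")
      case True
      then have "p + \<bar>s\<bar> \<in> I" using s by (intro int[OF p I(4)]) auto
      then show ?thesis by (auto simp: abs_if split: if_splits)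
    next
      case False
      then have "p - \<bar>s\<bar> \<in> I" using s by (intro int[OF I(3) p]) auto
      then show ?thesis by (auto simp: abs_if split: if_splits)
    qed
  qed
  have [measurable]: "Measurable.pred lebesgue (\<lambda>y. l2_fun x y + t * l2_fun w y \<in> I)"
    by (rule pred_sets2[OF I(2)]) measurable
  have "\<exists>z. AE y in lebesgue. l2_fun z y = ?g y"
  proof (rule l2_realise[of _ x "t *\<^sub>R w"])
    show "AE y in lebesgue. \<bar>?g y\<bar> \<le> \<bar>l2_fun x y\<bar> + \<bar>l2_fun (t *\<^sub>R w) y\<bar>"
      using l2_fun_scaleR[of t w] by eventually_elim auto
  qed measurable
  then obtain z where z: "AE y in lebesgue. l2_fun z y = ?g y" by blast
  have w0: "AE y in lebesgue. y \<notin> \<Omega> \<longrightarrow> l2_fun w y = 0" using w(1) by (simp add: L2_def)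
  have "AE y in lebesgue. l2_fun z y \<in> (if y \<in> \<Omega> then I else {0}) \<and>
      l2_fun (z + t *\<^sub>R w) y \<in> (if y \<in> \<Omega> then I else {0})"
    using z w0 w(2) L2_inD[OF x] l2_fun_add[of z "t *\<^sub>R w"] l2_fun_scaleR[of t w]
  proof eventually_elim
    case (elim y)
    have "2 * \<bar>t * l2_fun w y\<bar> \<le> \<beta> - \<alpha>"
      using mult_left_mono[OF elim(3) t(1)] t by (simp add: abs_mult)
    then show ?case using elim move[of "l2_fun x y" "t * l2_fun w y"] by auto
  qed
  then have "z \<in> L2_in \<Omega> I" "z + t *\<^sub>R w \<in> L2_in \<Omega> I"
    by (auto intro!: L2_in_I elim: eventually_mono)
  moreover have "norm (z - x) \<le> norm (t *\<^sub>R w)"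
    by (rule l2_norm_mono) (use z l2_fun_diff[of z x] l2_fun_scaleR[of t w] in eventually_elim, auto)
  moreover have "AE y in lebesgue. l2_fun w y = 0 \<longrightarrow> l2_fun (z - x) y = 0"
    using z l2_fun_diff[of z x] by eventually_elim auto
  ultimately show ?thesis using t by auto
qed

text \<open>
  Truncation at height \<open>k\<close>, which converges by dominated convergence. It creates no new nonzero values, so
  truncated critical directions remain critical.
\<close>

lemma L2_bounded_approximation:
  assumes w: "w \<in> L2 \<Omega>"
  shows "\<exists>s. s \<longlonglongrightarrow> w \<and> (\<forall>k. s k \<in> L2 \<Omega> \<and> (AE y in lebesgue. \<bar>l2_fun (s k) y\<bar> \<le> real k)
    \<and> (AE y in lebesgue. l2_fun w y = 0 \<longrightarrow> l2_fun (s k) y = 0))"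
proof -
  let ?g = "\<lambda>k y. if \<bar>l2_fun w y\<bar> \<le> real k then l2_fun w y else 0"
  have "\<exists>c. AE y in lebesgue. l2_fun c y = ?g k y" for k
    by (rule l2_realise[of _ w 0]) auto
  then have "\<exists>s. \<forall>k. AE y in lebesgue. l2_fun (s k) y = ?g k y" by (intro choice allI)
  then obtain s where s: "\<And>k. AE y in lebesgue. l2_fun (s k) y = ?g k y" by blast
  have "(\<lambda>k. (norm (s k - w))\<^sup>2) \<longlonglongrightarrow> (\<integral>y. 0 \<partial>(lebesgue :: 'a measure))"
    unfolding norm_l2_power2
  proof (rule integral_dominated_convergence)
    show "integrable lebesgue (\<lambda>y. (l2_fun w y)\<^sup>2)"
      using square_integrable_l2_fun[of w] by (simp add: square_integrable_def)
    show "AE y in lebesgue. norm ((l2_fun (s k - w) y)\<^sup>2) \<le> (l2_fun w y)\<^sup>2" for k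
      using s[of k] l2_fun_diff[of "s k" w] by eventually_elim auto
    have "AE y in lebesgue. \<forall>k. l2_fun (s k - w) y = ?g k y - l2_fun w y"
      unfolding AE_all_countable
    proof
      fix k show "AE y in lebesgue. l2_fun (s k - w) y = ?g k y - l2_fun w y"
        using s[of k] l2_fun_diff[of "s k" w] by eventually_elim simp
    qed
    then show "AE y in lebesgue. (\<lambda>k. (l2_fun (s k - w) y)\<^sup>2) \<longlonglongrightarrow> 0"
    proof eventually_elim
      case (elim y)
      obtain K where "\<bar>l2_fun w y\<bar> \<le> real K" using real_arch_simple by blast
      then have "\<forall>\<^sub>F k in sequentially. (l2_fun (s k - w) y)\<^sup>2 = 0"
        using elim by (intro eventually_sequentiallyI[of K]) (auto dest: order_trans)
      then show ?case by (rule tendsto_eventually)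
    qed
  qed auto
  then have "(\<lambda>k. sqrt ((norm (s k - w))\<^sup>2)) \<longlonglongrightarrow> sqrt 0" by (intro tendsto_real_sqrt) simp
  then have "s \<longlonglongrightarrow> w" by (simp add: tendsto_norm_zero_iff LIM_zero_iff)
  moreover have "s k \<in> L2 \<Omega>" for k
  proof -
    have "AE y in lebesgue. y \<notin> \<Omega> \<longrightarrow> l2_fun w y = 0" using w by (simp add: L2_def)
    with s[of k] show ?thesis unfolding L2_def mem_Collect_eq by eventually_elim auto
  qed
  moreover have "AE y in lebesgue. \<bar>l2_fun (s k) y\<bar> \<le> real k" for k
    using s[of k] by eventually_elim auto
  moreover have "AE y in lebesgue. l2_fun w y = 0 \<longrightarrow> l2_fun (s k) y = 0" for k
    using s[of k] by eventually_elim auto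
  ultimately show ?thesis by blast
qed

text \<open>
  The two points of the segment along \<open>w\<close> are solutions for the right-hand sides \<open>f x pb + u\<close>, as \<open>u\<close> is
  normal at both. Strong monotonicity of solutions with modulus \<open>\<kappa>\<close> and strict differentiability up to
  \<open>\<kappa> / 2\<close> leave the bound with \<open>\<gamma> = \<kappa> / 2\<close>, first for bounded \<open>w\<close> and then for their limits.
\<close>

lemma fully_stable_imp_coercive_on_critical:
  fixes f :: "'a::euclidean_space l2 \<Rightarrow> 'p::metric_space \<Rightarrow> 'a l2"
  assumes I: "convex I" "I \<in> sets borel" "\<alpha> \<in> I" "\<beta> \<in> I" "\<alpha> < \<beta>"
    and f: "\<forall>x\<in>L2 \<Omega>. \<forall>p. f x p \<in> L2 \<Omega>"
    and sol: "xb \<in> solution_map (L2 \<Omega>) (L2_in \<Omega> I) f vb pb"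
    and fr: "uniformly_frechet_at (L2 \<Omega>) f D xb pb"
    and stable: "fully_stable (L2 \<Omega>) (solution_map (L2 \<Omega>) (L2_in \<Omega> I) f) vb pb xb"
  shows "\<exists>\<gamma>>0. \<forall>w\<in>L2 \<Omega>. (AE y in lebesgue. l2_fun (vb - f xb pb) y * l2_fun w y = 0) \<longrightarrow>
    \<gamma> * (norm w)\<^sup>2 \<le> D xb pb w \<bullet> w"
proof -
  define u where "u = vb - f xb pb"
  have u: "u \<in> normal_cone (L2 \<Omega>) (L2_in \<Omega> I) xb"
    using sol by (simp add: solution_map_iff[OF L2_in_subset] u_def)
  then have xb: "xb \<in> L2_in \<Omega> I" "xb \<in> L2 \<Omega>" and uL: "u \<in> L2 \<Omega>"
    using L2_in_subset by (auto dest: normal_coneD)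
  interpret A: bounded_linear "D xb pb" by (rule uniformly_frechet_bounded_linear[OF fr])
  obtain \<kappa> r1 where \<kappa>: "\<kappa> > 0" "r1 > 0" and mono:
    "\<And>v1 v2 x1 x2. \<lbrakk>v1 \<in> L2 \<Omega>; v2 \<in> L2 \<Omega>;
      x1 \<in> L2 \<Omega> \<inter> solution_map (L2 \<Omega>) (L2_in \<Omega> I) f v1 pb;
      x2 \<in> L2 \<Omega> \<inter> solution_map (L2 \<Omega>) (L2_in \<Omega> I) f v2 pb;
      dist v1 vb < r1; dist v2 vb < r1; dist x1 xb < r1; dist x2 xb < r1\<rbrakk>
      \<Longrightarrow> \<kappa> * (norm (x1 - x2))\<^sup>2 \<le> (v1 - v2) \<bullet> (x1 - x2)"
    using fully_stable_imp_solution_monotone[OF stable] by blast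
  obtain r2 where r2: "r2 > 0" and strict:
    "\<And>x1 x2 p. \<lbrakk>x1 \<in> L2 \<Omega>; x2 \<in> L2 \<Omega>; dist x1 xb < r2; dist x2 xb < r2; dist p pb < r2\<rbrakk> \<Longrightarrow>
      norm (f x1 p - f x2 p - D xb pb (x1 - x2)) \<le> (\<kappa> / 2) * norm (x1 - x2)"
    using uniformly_frechet_strict[OF subspace_L2 fr, of "\<kappa> / 2"] \<kappa> by auto
  obtain M where M: "0 \<le> M" "\<And>x. norm (D xb pb x) \<le> norm x * M" using A.nonneg_bounded by blast
  define \<gamma> where "\<gamma> = \<kappa> / 2"
  have bounded_case: "\<gamma> * (norm w)\<^sup>2 \<le> D xb pb w \<bullet> w"
    if w: "w \<in> L2 \<Omega>" "AE y in lebesgue. l2_fun u y * l2_fun w y = 0"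
      and B: "AE y in lebesgue. \<bar>l2_fun w y\<bar> \<le> B" "0 \<le> B" for w B
  proof -
    \<comment> \<open>Points within \<open>R\<close> are admissible for \<open>mono\<close> and \<open>strict\<close>, right-hand sides included.\<close>
    define R where "R = min r1 r2 / (1 + M + \<kappa>)"
    have R: "0 < R" "R \<le> r1" "R \<le> r2" "R * (M + \<kappa> / 2) < r1"
    proof -
      show "0 < R" using \<kappa> r2 M by (simp add: R_def)
      have "R * (1 + M + \<kappa>) = min r1 r2" using \<kappa> M by (simp add: R_def)
      then have "R + R * (M + \<kappa>) = min r1 r2" by (simp add: algebra_simps)
      moreover have "0 \<le> R * (M + \<kappa>)" "R * (M + \<kappa> / 2) \<le> R * (M + \<kappa>)"
        using \<open>0 < R\<close> M \<kappa> by auto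
      ultimately show "R \<le> r1" "R \<le> r2" "R * (M + \<kappa> / 2) < r1" using \<open>0 < R\<close> by linarith+
    qed
    \<comment> \<open>The summands \<open>1\<close> keep the denominators positive when \<open>w\<close> or \<open>B\<close> vanishes.\<close>
    define t where "t = min (R / (2 * norm w + 1)) ((\<beta> - \<alpha>) / (2 * B + 1)) / 2"
    have t: "0 < t" "2 * (t * norm w) < R" "2 * (t * B) \<le> \<beta> - \<alpha>"
    proof -
      show "0 < t" using R I B by (simp add: t_def add_nonneg_pos)
      have "2 * t \<le> R / (2 * norm w + 1)" by (simp add: t_def)
      moreover have "0 < 2 * norm w + 1" by (simp add: add_nonneg_pos)
      ultimately have "2 * t * (2 * norm w + 1) \<le> R" by (simp add: pos_le_divide_eq)
      then have "4 * (t * norm w) + 2 * t \<le> R" by (simp add: algebra_simps)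
      moreover have "0 \<le> t * norm w" using \<open>0 < t\<close> by simp
      ultimately show "2 * (t * norm w) < R" using \<open>0 < t\<close> by linarith
      have "2 * t \<le> (\<beta> - \<alpha>) / (2 * B + 1)" by (simp add: t_def)
      then have "2 * t * (2 * B + 1) \<le> \<beta> - \<alpha>" using B by (simp add: pos_le_divide_eq)
      then have "4 * (t * B) + 2 * t \<le> \<beta> - \<alpha>" by (simp add: algebra_simps)
      moreover have "0 \<le> t * B" using \<open>0 < t\<close> B by simp
      ultimately show "2 * (t * B) \<le> \<beta> - \<alpha>" using \<open>0 < t\<close> by linarith
    qed
    obtain z where z: "z \<in> L2_in \<Omega> I" "z + t *\<^sub>R w \<in> L2_in \<Omega> I" "norm (z - xb) \<le> t * norm w"
      "AE y in lebesgue. l2_fun w y = 0 \<longrightarrow> l2_fun (z - xb) y = 0"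
      using L2_in_segment_along[OF xb(1) w(1) B(1) I(1-4) _ t(3)] t(1) by auto
    define x where "x = z + t *\<^sub>R w"
    have x_diff: "x - z = t *\<^sub>R w" by (simp add: x_def)
    have zL: "z \<in> L2 \<Omega>" and xL: "x \<in> L2 \<Omega>" using z L2_in_subset by (auto simp: x_def)
    have near: "dist z xb < R" "dist x xb < R"
    proof -
      have "norm (x - xb) \<le> norm (z - xb) + norm (t *\<^sub>R w)"
        using norm_triangle_ineq[of "z - xb" "t *\<^sub>R w"] by (simp add: x_def algebra_simps)
      moreover have "norm (t *\<^sub>R w) = t * norm w" "0 \<le> t * norm w" using t by simp_all
      ultimately show "dist z xb < R" "dist x xb < R"
        unfolding dist_norm using z(3) t(2) by linarith+
    qed
    have "AE y in lebesgue. l2_fun u y * l2_fun (z - xb) y = 0"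
      using w(2) z(4) by eventually_elim auto
    moreover have "AE y in lebesgue. l2_fun u y * l2_fun (x - xb) y = 0"
    proof -
      have x_eq: "x - xb = (z - xb) + t *\<^sub>R w" by (simp add: x_def)
      show ?thesis
        unfolding x_eq using w(2) z(4) l2_fun_add[of "z - xb" "t *\<^sub>R w"] l2_fun_scaleR[of t w]
        by eventually_elim auto
    qed
    ultimately have uN: "u \<in> normal_cone (L2 \<Omega>) (L2_in \<Omega> I) z" "u \<in> normal_cone (L2 \<Omega>) (L2_in \<Omega> I) x"
      using z by (auto intro!: normal_cone_transfer[OF u] simp: x_def)
    have v_near: "dist (f q pb + u) vb < r1" if "q \<in> L2 \<Omega>" "dist q xb < R" for q
    proof -
      have "norm (f q pb - f xb pb) \<le> norm (D xb pb (q - xb)) + norm (f q pb - f xb pb - D xb pb (q - xb))"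
        by (rule norm_triangle_sub)
      also have "\<dots> \<le> norm (q - xb) * M + \<kappa> / 2 * norm (q - xb)"
        using that xb R r2 M by (intro add_mono strict) auto
      also have "\<dots> = norm (q - xb) * (M + \<kappa> / 2)" by (simp add: algebra_simps)
      also have "\<dots> \<le> R * (M + \<kappa> / 2)"
        using that M \<kappa> by (intro mult_right_mono) (auto simp: dist_norm)
      finally show ?thesis using R by (simp add: dist_norm u_def)
    qed
    have "\<kappa> * (norm (x - z))\<^sup>2 \<le> ((f x pb + u) - (f z pb + u)) \<bullet> (x - z)"
      using f uL xL zL near R uN v_near
      by (intro mono) (auto simp: solution_map_iff[OF L2_in_subset] intro: subspace_add[OF subspace_L2])
    also have "\<dots> = D xb pb (x - z) \<bullet> (x - z) + (f x pb - f z pb - D xb pb (x - z)) \<bullet> (x - z)"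
      by (simp add: inner_simps)
    also have "(f x pb - f z pb - D xb pb (x - z)) \<bullet> (x - z) \<le> (\<kappa> / 2 * norm (x - z)) * norm (x - z)"
      using xL zL near R r2
      by (intro order_trans[OF norm_cauchy_schwarz] mult_right_mono strict) auto
    finally have "\<gamma> * (norm (x - z))\<^sup>2 \<le> D xb pb (x - z) \<bullet> (x - z)"
      by (simp add: \<gamma>_def power2_eq_square)
    then have "t * t * (\<gamma> * (norm w)\<^sup>2) \<le> t * t * (D xb pb w \<bullet> w)"
      unfolding x_diff A.scaleR by (simp add: power_mult_distrib power2_eq_square mult_ac)
    then show ?thesis using t(1) by simp
  qed
  have "\<gamma> * (norm w)\<^sup>2 \<le> D xb pb w \<bullet> w"
    if w: "w \<in> L2 \<Omega>" "AE y in lebesgue. l2_fun u y * l2_fun w y = 0" for w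
  proof -
    obtain s where s: "s \<longlonglongrightarrow> w" "\<And>k. s k \<in> L2 \<Omega>" "\<And>k. AE y in lebesgue. \<bar>l2_fun (s k) y\<bar> \<le> real k"
      "\<And>k. AE y in lebesgue. l2_fun w y = 0 \<longrightarrow> l2_fun (s k) y = 0"
      using L2_bounded_approximation[OF w(1)] by blast
    have "\<gamma> * (norm (s k))\<^sup>2 \<le> D xb pb (s k) \<bullet> s k" for k
    proof (rule bounded_case[OF s(2) _ s(3)])
      show "AE y in lebesgue. l2_fun u y * l2_fun (s k) y = 0"
        using w(2) s(4)[of k] by eventually_elim auto
    qed simp
    moreover have "(\<lambda>k. \<gamma> * (norm (s k))\<^sup>2) \<longlonglongrightarrow> \<gamma> * (norm w)\<^sup>2"
      "(\<lambda>k. D xb pb (s k) \<bullet> s k) \<longlonglongrightarrow> D xb pb w \<bullet> w"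
      by (intro tendsto_intros A.tendsto s)+
    ultimately show ?thesis by (intro LIMSEQ_le) auto
  qed
  then show ?thesis using \<kappa> unfolding u_def \<gamma>_def by (intro exI[of _ "\<kappa> / 2"]) auto
qed

section \<open>The characterisation of full stability\<close>

lemma box_constraint_eq_L2_in:
  assumes "\<Omega> \<in> sets lebesgue"
  shows "box_constraint \<Omega> a b = L2_in \<Omega> {s. a \<le> ereal s \<and> ereal s \<le> b}"
  using assms by (auto simp: box_constraint_def L2_in_def AE_restrict_space_iff)

theorem corollary8p8:
  fixes \<Omega> :: "(real ^ 'n) set"
    and a b :: ereal
    and f :: "(real ^ 'n) l2 \<Rightarrow> 'p::metric_space \<Rightarrow> (real ^ 'n) l2"
    and D :: "(real ^ 'n) l2 \<Rightarrow> 'p \<Rightarrow> (real ^ 'n) l2 \<Rightarrow> (real ^ 'n) l2"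
    and xb vb :: "(real ^ 'n) l2" and pb :: 'p
  assumes "open \<Omega>" and "a < b"
    and "\<forall>x\<in>L2 \<Omega>. \<forall>p. f x p \<in> L2 \<Omega>"
    and "xb \<in> solution_map (L2 \<Omega>) (box_constraint \<Omega> a b) f vb pb"
    and "locally_lipschitz_at (L2 \<Omega>) f xb pb"
    and "uniformly_frechet_at (L2 \<Omega>) f D xb pb"
    and "legendre_form (L2 \<Omega>) (\<lambda>w. D xb pb w \<bullet> w)"
  shows "fully_stable (L2 \<Omega>) (solution_map (L2 \<Omega>) (box_constraint \<Omega> a b) f) vb pb xb \<longleftrightarrow>
    (\<forall>w \<in> L2 \<Omega> - {0}.
       (AE y in lebesgue_on \<Omega>. l2_fun w y * (l2_fun vb y - l2_fun (f xb pb) y) = 0)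
       \<longrightarrow> D xb pb w \<bullet> w > 0)"
proof -
  define I where "I = {s. a \<le> ereal s \<and> ereal s \<le> b}"
  have \<Omega>: "\<Omega> \<in> sets lebesgue" using assms(1) by (simp add: lebesgue_openin borel_open)
  have box: "box_constraint \<Omega> a b = L2_in \<Omega> I"
    unfolding I_def by (rule box_constraint_eq_L2_in[OF \<Omega>])
  have I_convex: "convex I"
    unfolding is_interval_convex_1[symmetric] is_interval_1 I_def
    by (auto intro: order_trans ereal_less_eq(3)[THEN iffD2])
  have I_closed: "closed I"
    unfolding I_def by (intro closed_Collect_conj closed_Collect_le continuous_intros)
  obtain \<alpha> \<beta> where \<alpha>\<beta>: "\<alpha> \<in> I" "\<beta> \<in> I" "\<alpha> < \<beta>"
  proof -
    obtain \<alpha> where "a < ereal \<alpha>" "ereal \<alpha> < b" using ereal_dense2[OF assms(2)] by blast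
    moreover obtain \<beta> where "ereal \<alpha> < ereal \<beta>" "ereal \<beta> < b"
      using ereal_dense2[OF \<open>ereal \<alpha> < b\<close>] by blast
    moreover from calculation have "a < ereal \<beta>" by (blast intro: less_trans)
    ultimately show thesis by (intro that[of \<alpha> \<beta>]) (auto simp: I_def less_imp_le)
  qed
  have critical: "(AE y in lebesgue_on \<Omega>. l2_fun w y * (l2_fun vb y - l2_fun (f xb pb) y) = 0)
      \<longleftrightarrow> (AE y in lebesgue. l2_fun (vb - f xb pb) y * l2_fun w y = 0)" if "w \<in> L2 \<Omega>" for w
  proof -
    have w: "AE y in lebesgue. y \<notin> \<Omega> \<longrightarrow> l2_fun w y = 0" using that by (simp add: L2_def)
    have "AE y in lebesgue. (y \<in> \<Omega> \<longrightarrow> l2_fun w y * (l2_fun vb y - l2_fun (f xb pb) y) = 0)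
        \<longleftrightarrow> l2_fun (vb - f xb pb) y * l2_fun w y = 0"
      using w l2_fun_diff[of vb "f xb pb"] by eventually_elim auto
    from eventually_subst[OF this] show ?thesis
      using \<Omega> by (simp add: AE_restrict_space_iff)
  qed
  show ?thesis
  proof
    assume "fully_stable (L2 \<Omega>) (solution_map (L2 \<Omega>) (box_constraint \<Omega> a b) f) vb pb xb"
    then obtain \<gamma> where "\<gamma> > 0" and coercive: "\<And>w. w \<in> L2 \<Omega> \<Longrightarrow>
        (AE y in lebesgue. l2_fun (vb - f xb pb) y * l2_fun w y = 0) \<Longrightarrow> \<gamma> * (norm w)\<^sup>2 \<le> D xb pb w \<bullet> w"
      using fully_stable_imp_coercive_on_critical[OF I_convex borel_closed[OF I_closed] \<alpha>\<beta> assms(3) _ assms(6)]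
        assms(4) unfolding box by blast
    show "\<forall>w \<in> L2 \<Omega> - {0}.
       (AE y in lebesgue_on \<Omega>. l2_fun w y * (l2_fun vb y - l2_fun (f xb pb) y) = 0)
       \<longrightarrow> D xb pb w \<bullet> w > 0"
    proof (intro ballI impI)
      fix w assume w: "w \<in> L2 \<Omega> - {0}"
        and "AE y in lebesgue_on \<Omega>. l2_fun w y * (l2_fun vb y - l2_fun (f xb pb) y) = 0"
      then have "\<gamma> * (norm w)\<^sup>2 \<le> D xb pb w \<bullet> w" using critical coercive by blast
      moreover have "0 < \<gamma> * (norm w)\<^sup>2" using w \<open>\<gamma> > 0\<close> by simp
      ultimately show "D xb pb w \<bullet> w > 0" by linarith
    qed
  next
    assume pos: "\<forall>w \<in> L2 \<Omega> - {0}.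
       (AE y in lebesgue_on \<Omega>. l2_fun w y * (l2_fun vb y - l2_fun (f xb pb) y) = 0)
       \<longrightarrow> D xb pb w \<bullet> w > 0"
    have "locally_strongly_monotone (L2 \<Omega>) (L2_in \<Omega> I) f (vb - f xb pb) xb pb"
      using pos critical
      by (intro critical_positivity_imp_locally_strongly_monotone[OF \<Omega> assms(6,7)]) blast
    then show "fully_stable (L2 \<Omega>) (solution_map (L2 \<Omega>) (box_constraint \<Omega> a b) f) vb pb xb"
      using assms(3-5) I_closed I_convex \<alpha>\<beta> unfolding box
      by (intro fully_stable_if_locally_strongly_monotone subspace_L2 L2_in_subset closed_L2_in[OF \<Omega>]
          convex_L2_in) auto
  qed
qed

end
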